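(* The complete bipartite graph $K_{p,q}$ with $p\ge 3$ and $q\ge 3$ is mature.
   Context: A graph means a finite 1-dimensional simplicial complex. $K_{p,q}$ has vertex set $P\sqcup Q$ with $|P|=p$, $|Q|=q$, and every vertex of $P$ is joined by an edge to every vertex of $Q$ (with no other edges). For a space $X$, $F(X,2)=\{(x,y)\in X\times X: x\neq y\}$. Homology is with integer coefficients. A finite connected graph $\Gamma$ which is not homeomorphic to the interval $[0,1]$ is called mature if the homomorphism $\alpha_*:H_1(F(\Gamma,2))\to H_1(\Gamma\times\Gamma)$ induced by the inclusion $\alpha:F(\Gamma,2)\to\Gamma\times\Gamma$ is an isomorphism. *)

theory Defs
  imports "HOL-Homology.Homology"
begin

text \<open>A graph is an abstract simplicial complex, given by its nonempty simplices: vertices are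
  the one-element members of \<open>K\<close>, edges the two-element members.\<close>

definition graph_complex :: "'v set set \<Rightarrow> bool" where
  "graph_complex K \<longleftrightarrow>
     finite K \<and>
     (\<forall>\<sigma>\<in>K. finite \<sigma> \<and> \<sigma> \<noteq> {}) \<and>
     (\<forall>\<sigma>\<in>K. \<forall>\<tau>. \<tau> \<subseteq> \<sigma> \<and> \<tau> \<noteq> {} \<longrightarrow> \<tau> \<in> K) \<and>
     (\<forall>\<sigma>\<in>K. card \<sigma> \<le> 2) \<and> (\<exists>\<sigma>\<in>K. card \<sigma> = 2)"

text \<open>Points are given by barycentric coordinates, as for \<open>standard_simplex\<close>.  For finite \<open>K\<close>
  the product topology induces the usual topology of the polyhedron.\<close>

definition geometric_realization :: "'v set set \<Rightarrow> ('v \<Rightarrow> real) topology" where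
  "geometric_realization K =
     subtopology (powertop_real UNIV)
       {x. (\<forall>v. 0 \<le> x v) \<and> {v. x v \<noteq> 0} \<in> K \<and> (\<Sum>v | x v \<noteq> 0. x v) = 1}"

definition config_space2 :: "'a topology \<Rightarrow> ('a \<times> 'a) topology" where
  "config_space2 X = subtopology (prod_topology X X) {(x, y). x \<noteq> y}"

definition mature :: "'v set set \<Rightarrow> bool" where
  "mature K \<longleftrightarrow>
     graph_complex K \<and>
     connected_space (geometric_realization K) \<and>
     \<not> geometric_realization K homeomorphic_space top_of_set {0..1::real} \<and>
     (let X = geometric_realization K in
        hom_induced 1 (config_space2 X) {} (prod_topology X X) {} id
          \<in> iso (homology_group 1 (config_space2 X)) (homology_group 1 (prod_topology X X)))"

definition complete_bipartite :: "'v set \<Rightarrow> 'v set \<Rightarrow> 'v set set" where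
  "complete_bipartite P Q = {{v} | v. v \<in> P \<union> Q} \<union> {{u, v} | u v. u \<in> P \<and> v \<in> Q}"

end

theory Submission
  imports Defs
begin

text \<open>
  Write \<open>X\<close> for the realization of the graph, \<open>V = P \<union> Q\<close>, and \<open>F\<close> for the configuration space.
  The product \<open>X \<times> X\<close> is covered by the open sets \<open>{x\<^sub>u > 0, y\<^sub>v > 0}\<close>, one for each pair \<open>(u, v)\<close> of
  vertices, and \<open>F\<close> by the open sets \<open>{x\<^sub>u > y\<^sub>u, y\<^sub>v > x\<^sub>v}\<close> for \<open>u \<noteq> v\<close>: the barycentric coordinates of
  two distinct points have the same sum, so each point exceeds the other somewhere.  All these
  cells are star-shaped about the pair of vertices \<open>(u, v)\<close>, and any point of an overlap of two of
  them can be joined to one fixed midpoint by a straight segment inside the overlap.  Hence, modulo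
  boundaries, a path inside a cell is the difference of two straight spokes, and on the overlap of
  two cells the spokes differ by a class \<open>step w w'\<close> that depends on the two cells only.  Steps
  satisfy the cocycle rule, so they sum to zero around the product of two disjoint edges
  (\<open>step_square\<close>).

  The heart of the matter is combinatorial (\<open>grid_cocycle_splits\<close>).  Modulo boundaries of \<open>F\<close>, a step
  that moves the first point along the edge \<open>xy\<close> while the second rests at a vertex \<open>a\<close> off it has the form
  \<open>\<phi> x y + c (y, a) - c (x, a)\<close>, and similarly for the second point with some \<open>\<psi>\<close> and the same \<open>c\<close>.
  Here \<open>\<phi> x y\<close> and \<open>\<psi> x y\<close> are sums of steps around a 4-cycle through \<open>xy\<close>, the other point resting
  off the cycle.  This is where \<open>p, q \<ge> 3\<close> enters: the complement of a 4-cycle is nonempty and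
  connected, so the resting vertex does not matter, and the complete bipartite graph on two
  vertices of one side and three of the other, which carries the additivity relations between
  4-cycles, still misses a vertex.

  Injectivity on first homology (\<open>inclusion_injective\<close>): send each point of \<open>X\<close> to a vertex of its
  carrier and give the pair \<open>(x, y)\<close>, seen from the cell of \<open>(u, v)\<close>, the height obtained by applying
  \<open>\<phi>\<close> and \<open>\<psi>\<close> to the edges from \<open>u\<close> and \<open>v\<close> to these vertices.  On overlaps, even of the larger cells
  of \<open>X \<times> X\<close>, heights differ by constants, so the change of height along a small path is well defined
  on \<open>X \<times> X\<close> and adds up to zero over the boundary of a small 2-chain.  On \<open>F\<close> the functions spoke
  minus height plus \<open>c\<close> agree on overlaps, so a small cycle of \<open>F\<close> is homologous in \<open>F\<close> to its total
  change of height.  If it bounds in \<open>X \<times> X\<close>, then after subdivision that total is zero.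

  Surjectivity (\<open>inclusion_surjective\<close>): modulo boundaries of \<open>X \<times> X\<close> and cycles of \<open>F\<close> the classes \<open>\<phi>\<close>
  and \<open>\<psi>\<close> vanish, because they are cycles of \<open>F\<close>, and \<open>c\<close> extends to the diagonal pairs \<open>(x, x)\<close>.  So
  the functions spoke plus \<open>c\<close> agree on overlaps in \<open>X \<times> X\<close>, and every cycle of \<open>X \<times> X\<close> is trivial in
  this quotient.

  Finally \<open>X\<close> stays connected when a vertex is removed, whereas only the two end points of an
  interval have this property; as there are three vertices, \<open>X\<close> is not an interval.
\<close>

section \<open>Cocycles on a grid, modulo a subgroup\<close>

text \<open>
  Homology classes are handled as chains modulo a subgroup, so that no quotient type is needed:
  \<open>a \<equiv> b\<close> means that \<open>a - b\<close> lies in the subgroup.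
\<close>

definition additive_subgroup :: "'a::ab_group_add set \<Rightarrow> bool" where
  "additive_subgroup N \<longleftrightarrow> 0 \<in> N \<and> (\<forall>x\<in>N. \<forall>y\<in>N. x - y \<in> N)"

lemma additive_subgroupD:
  assumes "additive_subgroup N"
  shows "0 \<in> N" and "x \<in> N \<Longrightarrow> y \<in> N \<Longrightarrow> x - y \<in> N"
    and "x \<in> N \<Longrightarrow> - x \<in> N" and "x \<in> N \<Longrightarrow> y \<in> N \<Longrightarrow> x + y \<in> N"
proof -
  have diff: "x - y \<in> N" if "x \<in> N" "y \<in> N" for x y
    using assms that by (auto simp: additive_subgroup_def)
  show 0: "0 \<in> N" using assms by (simp add: additive_subgroup_def)
  have neg: "- x \<in> N" if "x \<in> N" for x
    using diff[OF 0 that] by simp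
  show "x \<in> N \<Longrightarrow> y \<in> N \<Longrightarrow> x - y \<in> N" "x \<in> N \<Longrightarrow> - x \<in> N"
    by (rule diff neg; assumption)+
  show "x + y \<in> N" if "x \<in> N" "y \<in> N"
    using diff[OF that(1) neg[OF that(2)]] by simp
qed

text \<open>
  Read \<open>A p q a\<close> as the class of moving the first point along the edge \<open>pq\<close> while the second rests
  at \<open>a\<close>, and \<open>B a p q\<close> as the reverse.  Let \<open>L a i i' j j'\<close> be the sum of \<open>A\<close> around the 4-cycle on
  \<open>i, i' \<in> P\<close> and \<open>j, j' \<in> Q\<close>.  Moving the resting point across an edge off the cycle changes \<open>L\<close> by a
  telescoping sum of values of \<open>B\<close>, so \<open>L\<close> does not depend on \<open>a\<close>.  For fixed \<open>a\<close> it is additive in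
  each pair, hence is determined by the cycles through two base vertices \<open>p0\<close>, \<open>q0\<close>.  Subtracting these
  values from \<open>A\<close> leaves, for each \<open>a\<close>, a cochain that vanishes on all 4-cycles of the graph without
  \<open>a\<close>; as 4-cycles generate its cycles, it is the coboundary of some \<open>g a\<close>.
\<close>

lemma four_cycle_exactness:
  fixes A B :: "'v \<Rightarrow> 'v \<Rightarrow> 'v \<Rightarrow> 'a::ab_group_add"
  assumes N: "additive_subgroup N" and PQ: "P \<inter> Q = {}"
    and P3: "\<And>x y. \<exists>z\<in>P. z \<noteq> x \<and> z \<noteq> y" and Q3: "\<And>x y. \<exists>z\<in>Q. z \<noteq> x \<and> z \<noteq> y"
    and square: "\<And>p p' q q'. \<lbrakk>p \<in> P; p' \<in> P; q \<in> Q; q' \<in> Q; p \<noteq> p'; q \<noteq> q'\<rbrakk> \<Longrightarrow>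
      A p q p' - A p q q' + B q p' q' - B p p' q' \<in> N"
  obtains \<phi> g where
    "\<And>p q a. \<lbrakk>p \<in> P; q \<in> Q; a \<in> P \<union> Q; a \<noteq> p; a \<noteq> q\<rbrakk> \<Longrightarrow>
       A p q a - (\<phi> p q + g a q - g a p) \<in> N"
    and "\<And>p q. p \<in> P \<Longrightarrow> q \<in> Q \<Longrightarrow> \<exists>p0\<in>P. \<exists>q0\<in>Q. \<exists>a\<in>P - {p, p0}.
       \<phi> p q = A p q a - A p0 q a + A p0 q0 a - A p q0 a"
proof -
  note sub = additive_subgroupD[OF N]
  define L where "L a i i' j j' = A i j a - A i' j a + A i' j' a - A i j' a" for a i i' j j'
  have L_PQ: "L p' i i' j j' - L q' i i' j j' \<in> N"
    if "i \<in> P" "i' \<in> P" "j \<in> Q" "j' \<in> Q" "p' \<in> P" "q' \<in> Q" "p' \<noteq> i" "p' \<noteq> i'" "q' \<noteq> j" "q' \<noteq> j'"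
    for p' q' i i' j j'
  proof -
    let ?D = "\<lambda>p q. A p q p' - A p q q' + B q p' q' - B p p' q'"
    have "?D i j - ?D i' j + ?D i' j' - ?D i j' \<in> N"
      using that by (intro square sub) auto
    then show ?thesis by (simp add: L_def algebra_simps)
  qed
  have L_indep: "L a i i' j j' - L b i i' j j' \<in> N"
    if ij: "i \<in> P" "i' \<in> P" "j \<in> Q" "j' \<in> Q"
      and a: "a \<in> P \<union> Q" "a \<notin> {i, i', j, j'}" and b: "b \<in> P \<union> Q" "b \<notin> {i, i', j, j'}"
    for a b i i' j j'
  proof -
    obtain p' where p': "p' \<in> P" "p' \<noteq> i" "p' \<noteq> i'" using P3 by blast
    obtain q' where q': "q' \<in> Q" "q' \<noteq> j" "q' \<noteq> j'" using Q3 by blast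
    have to_q': "L a i i' j j' - L q' i i' j j' \<in> N" if "a \<in> P \<union> Q" "a \<notin> {i, i', j, j'}" for a
    proof (cases "a \<in> P")
      case True
      then show ?thesis using L_PQ ij q' that by auto
    next
      case False
      have 1: "L p' i i' j j' - L a i i' j j' \<in> N" and 2: "L p' i i' j j' - L q' i i' j j' \<in> N"
        using L_PQ ij p' q' that False by auto
      show ?thesis using sub(2)[OF 2 1] by simp
    qed
    show ?thesis using sub(2)[OF to_q'[OF a] to_q'[OF b]] by simp
  qed
  obtain p0 where p0: "p0 \<in> P" using P3 by blast
  obtain q0 where q0: "q0 \<in> Q" using Q3 by blast
  obtain \<theta> where \<theta>: "\<And>p q::'v. \<theta> p q \<in> P - {p, p0}"
  proof -
    have "\<forall>p. \<exists>a. a \<in> P - {p, p0}" using P3 by blast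
    then obtain t where "\<forall>p. t p \<in> P - {p, p0}" by (rule choice[THEN exE])
    then show thesis using that[of "\<lambda>p q. t p"] by blast
  qed
  define \<phi> where "\<phi> p q = L (\<theta> p q) p p0 q q0" for p q
  \<comment> \<open>The cycles compared here may use up three vertices of \<open>Q\<close>, so the common resting vertex is taken
    in \<open>P\<close>, where they use only \<open>i\<close> and \<open>p0\<close>.\<close>
  have L_phi0: "L a i p0 j j' - (\<phi> i j - \<phi> i j') \<in> N"
    if ij: "i \<in> P" "j \<in> Q" "j' \<in> Q" and a: "a \<in> P \<union> Q" "a \<notin> {i, p0, j, j'}" for a i j j'
  proof -
    obtain b where b: "b \<in> P" "b \<noteq> i" "b \<noteq> p0" using P3 by blast
    have outside: "b \<notin> Q" "\<theta> i j \<notin> Q" "\<theta> i j' \<notin> Q" using b PQ \<theta> by blast+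
    have 1: "L a i p0 j j' - L b i p0 j j' \<in> N"
      using ij a b outside p0 by (intro L_indep) auto
    have 2: "L b i p0 j q0 - \<phi> i j \<in> N" and 3: "L b i p0 j' q0 - \<phi> i j' \<in> N"
      unfolding \<phi>_def using ij b p0 q0 outside \<theta>[of i j] \<theta>[of i j'] by (auto intro!: L_indep)
    have eq: "L a i p0 j j' - (\<phi> i j - \<phi> i j') =
        (L a i p0 j j' - L b i p0 j j') + (L b i p0 j q0 - \<phi> i j) - (L b i p0 j' q0 - \<phi> i j')"
      by (simp add: L_def algebra_simps)
    show ?thesis unfolding eq by (intro 1 2 3 sub)
  qed
  \<comment> \<open>Now the cycles may use up three vertices of \<open>P\<close>, and the common resting vertex is taken in \<open>Q\<close>.\<close>
  have L_phi: "L a i i' j j' - (\<phi> i j - \<phi> i j' - \<phi> i' j + \<phi> i' j') \<in> N"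
    if ij: "i \<in> P" "i' \<in> P" "j \<in> Q" "j' \<in> Q" and a: "a \<in> P \<union> Q" "a \<notin> {i, i', j, j'}" for a i i' j j'
  proof -
    obtain b where b: "b \<in> Q" "b \<noteq> j" "b \<noteq> j'" using Q3 by blast
    have outside: "b \<notin> P" using b PQ by blast
    have 1: "L a i i' j j' - L b i i' j j' \<in> N"
      using ij a b outside p0 by (intro L_indep) auto
    have 2: "L b i p0 j j' - (\<phi> i j - \<phi> i j') \<in> N" and 3: "L b i' p0 j j' - (\<phi> i' j - \<phi> i' j') \<in> N"
      using ij b outside p0 by (auto intro!: L_phi0)
    have eq: "L a i i' j j' - (\<phi> i j - \<phi> i j' - \<phi> i' j + \<phi> i' j') =
        (L a i i' j j' - L b i i' j j') + (L b i p0 j j' - (\<phi> i j - \<phi> i j')) - (L b i' p0 j j' - (\<phi> i' j - \<phi> i' j'))"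
      by (simp add: L_def algebra_simps)
    show ?thesis unfolding eq by (intro 1 2 3 sub)
  qed
  have "\<forall>a. \<exists>r s. r \<in> P \<and> r \<noteq> a \<and> s \<in> Q \<and> s \<noteq> a" using P3 Q3 by metis
  then obtain r s where rs: "\<And>a. r a \<in> P" "\<And>a. r a \<noteq> a" "\<And>a. s a \<in> Q" "\<And>a. s a \<noteq> a"
    by metis
  \<comment> \<open>Integrate the remainder along the paths \<open>p, s a, r a, q\<close>, which avoid \<open>a\<close>.\<close>
  define R where "R a p q = A p q a - \<phi> p q" for a p q
  define g where "g a x = (if x \<in> P then R a (r a) (s a) - R a x (s a) else R a (r a) x)" for a x
  show thesis
  proof (rule that)
    fix p q a assume pqa: "p \<in> P" "q \<in> Q" "a \<in> P \<union> Q" "a \<noteq> p" "a \<noteq> q"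
    then have "q \<notin> P" using PQ by blast
    have "L a p (r a) q (s a) - (\<phi> p q - \<phi> p (s a) - \<phi> (r a) q + \<phi> (r a) (s a)) \<in> N"
      using pqa rs[of a] by (intro L_phi) auto
    then show "A p q a - (\<phi> p q + g a q - g a p) \<in> N"
      using \<open>p \<in> P\<close> \<open>q \<notin> P\<close> by (simp add: g_def R_def L_def algebra_simps)
  next
    fix p q
    show "\<exists>p0\<in>P. \<exists>q0\<in>Q. \<exists>a\<in>P - {p, p0}.
       \<phi> p q = A p q a - A p0 q a + A p0 q0 a - A p q0 a"
      using p0 q0 \<theta>[of p q] unfolding \<phi>_def L_def by blast
  qed
qed

text \<open>
  The two potentials produced for the two points need not agree; their difference \<open>k\<close> has vanishing
  mixed second differences over disjoint pairs of edges.  Such a \<open>k\<close> is a sum of two functions of one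
  variable: the difference of \<open>k\<close> between two vertices of one side, put in one of the variables, does not
  change while the other variable runs over the opposite side, as one sees by comparing with a third
  vertex of the first side.
\<close>

lemma mixed_difference_splits:
  fixes k :: "'v \<Rightarrow> 'v \<Rightarrow> 'a::ab_group_add"
  assumes N: "additive_subgroup N" and PQ: "P \<inter> Q = {}"
    and P3: "\<And>x y. \<exists>z\<in>P. z \<noteq> x \<and> z \<noteq> y" and Q3: "\<And>x y. \<exists>z\<in>Q. z \<noteq> x \<and> z \<noteq> y"
    and square: "\<And>p p' q q'. \<lbrakk>p \<in> P; p' \<in> P; q \<in> Q; q' \<in> Q; p \<noteq> p'; q \<noteq> q'\<rbrakk> \<Longrightarrow>
      k q p' - k p p' - k q q' + k p q' \<in> N"
  obtains a b where "\<And>x u. \<lbrakk>x \<in> P \<union> Q; u \<in> P \<union> Q; x \<noteq> u\<rbrakk> \<Longrightarrow> k x u - (a u + b x) \<in> N"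
proof -
  note sub = additive_subgroupD[OF N]
  obtain x0 where x0: "x0 \<in> P" using P3 by blast
  obtain y0 where y0: "y0 \<in> Q" using Q3 by blast
  obtain v0 where v0: "v0 \<in> Q" "v0 \<noteq> y0" using Q3 by blast
  have QP: "k y u - k y' u - (k y u' - k y' u') \<in> N"
    if "y \<in> Q" "y' \<in> Q" "u \<in> P" "u' \<in> P" for y y' u u'
  proof -
    obtain v where v: "v \<in> Q" "v \<noteq> y" "v \<noteq> y'" using Q3 by blast
    obtain x where x: "x \<in> P" "x \<noteq> u" "x \<noteq> u'" using P3 by blast
    let ?D = "\<lambda>y u. k y u - k x u - k y v + k x v"
    have "?D y u - ?D y' u - (?D y u' - ?D y' u') \<in> N"
      using that x v by (intro square sub) auto
    then show ?thesis by (simp add: algebra_simps)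
  qed
  have PQ': "k x v - k x v' - (k x' v - k x' v') \<in> N"
    if "x \<in> P" "x' \<in> P" "v \<in> Q" "v' \<in> Q" for x x' v v'
  proof -
    obtain y where y: "y \<in> Q" "y \<noteq> v" "y \<noteq> v'" using Q3 by blast
    obtain u where u: "u \<in> P" "u \<noteq> x" "u \<noteq> x'" using P3 by blast
    let ?D = "\<lambda>x v. k y u - k x u - k y v + k x v"
    have "?D x v - ?D x v' - (?D x' v - ?D x' v') \<in> N"
      using that u y by (intro square sub) auto
    then show ?thesis by (simp add: algebra_simps)
  qed
  \<comment> \<open>Base points: on \<open>P\<close>, \<open>a\<close> is read off in the row \<open>y0\<close>, so \<open>b y0 = 0\<close>; the constants in the second
    branch match this normalization.\<close>
  define a where "a u = (if u \<in> P then k y0 u else k x0 u - k x0 v0 + k y0 v0)" for u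
  define b where "b x = (if x \<in> P then k x v0 - k y0 v0 else k x x0 - k y0 x0)" for x
  have a_simps: "\<And>u. u \<in> P \<Longrightarrow> a u = k y0 u" "\<And>u. u \<in> Q \<Longrightarrow> a u = k x0 u - k x0 v0 + k y0 v0"
    and b_simps: "\<And>x. x \<in> P \<Longrightarrow> b x = k x v0 - k y0 v0" "\<And>x. x \<in> Q \<Longrightarrow> b x = k x x0 - k y0 x0"
    using PQ by (auto simp: a_def b_def)
  have PP: "k x u - (a u + b x) \<in> N" if xu: "x \<in> P" "u \<in> P" "x \<noteq> u" for x u
  proof -
    have "k y0 u - k x u - k y0 v0 + k x v0 \<in> N" using xu y0 v0 by (intro square) auto
    from sub(3)[OF this] show ?thesis using xu by (simp add: a_simps b_simps algebra_simps)
  qed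
  have QPs: "k y u - (a u + b y) \<in> N" if yu: "y \<in> Q" "u \<in> P" for y u
    using QP[of y y0 u x0] yu y0 x0 by (simp add: a_simps b_simps algebra_simps)
  have PQs: "k x v - (a v + b x) \<in> N" if xv: "x \<in> P" "v \<in> Q" for x v
    using PQ'[of x x0 v v0] xv x0 v0 by (simp add: a_simps b_simps algebra_simps)
  have QQ: "k y v - (a v + b y) \<in> N" if yv: "y \<in> Q" "v \<in> Q" "y \<noteq> v" for y v
  proof -
    obtain u where u: "u \<in> P" "u \<noteq> x0" using P3 by blast
    have 1: "k y u - k x0 u - k y v + k x0 v \<in> N"
      using yv x0 u by (intro square) auto
    have eq: "k y v - (a v + b y) = (k y u - (a u + b y)) + (k x0 v - (a v + b x0))
        - (k x0 u - (a u + b x0)) - (k y u - k x0 u - k y v + k x0 v)"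
      by (simp add: algebra_simps)
    show ?thesis unfolding eq using yv x0 u by (intro 1 PP QPs PQs sub) auto
  qed
  show thesis
    using that[of a b] PP QPs PQs QQ by blast
qed

text \<open>
  Applying the previous result to each of the two points gives potentials \<open>g\<close> and \<open>h\<close>.  By the splitting
  of their difference, both can be corrected by functions that are constant along the moves of the
  respective point, after which they become a single potential \<open>c\<close> on pairs of distinct vertices.
\<close>

lemma grid_cocycle_splits:
  fixes A B :: "'v \<Rightarrow> 'v \<Rightarrow> 'v \<Rightarrow> 'a::ab_group_add"
  assumes N: "additive_subgroup N" and PQ: "P \<inter> Q = {}"
    and P3: "\<And>x y. \<exists>z\<in>P. z \<noteq> x \<and> z \<noteq> y" and Q3: "\<And>x y. \<exists>z\<in>Q. z \<noteq> x \<and> z \<noteq> y"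
    and square: "\<And>p p' q q'. \<lbrakk>p \<in> P; p' \<in> P; q \<in> Q; q' \<in> Q; p \<noteq> p'; q \<noteq> q'\<rbrakk> \<Longrightarrow>
      A p q p' - A p q q' + B q p' q' - B p p' q' \<in> N"
  obtains \<phi> \<psi> c where
    "\<And>p q a. \<lbrakk>p \<in> P; q \<in> Q; a \<in> P \<union> Q; a \<noteq> p; a \<noteq> q\<rbrakk> \<Longrightarrow>
       A p q a - (\<phi> p q + c (q, a) - c (p, a)) \<in> N"
    and "\<And>p q a. \<lbrakk>p \<in> P; q \<in> Q; a \<in> P \<union> Q; a \<noteq> p; a \<noteq> q\<rbrakk> \<Longrightarrow>
       B a p q - (\<psi> p q + c (a, q) - c (a, p)) \<in> N"
    and "\<And>p q. p \<in> P \<Longrightarrow> q \<in> Q \<Longrightarrow> \<exists>p0\<in>P. \<exists>q0\<in>Q. \<exists>a\<in>P - {p, p0}.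
       \<phi> p q = A p q a - A p0 q a + A p0 q0 a - A p q0 a"
    and "\<And>p q. p \<in> P \<Longrightarrow> q \<in> Q \<Longrightarrow> \<exists>p0\<in>P. \<exists>q0\<in>Q. \<exists>a\<in>P - {p, p0}.
       \<psi> p q = B a p q - B a p0 q + B a p0 q0 - B a p q0"
proof -
  note sub = additive_subgroupD[OF N]
  obtain \<phi> g where \<phi>g: "\<And>p q a. \<lbrakk>p \<in> P; q \<in> Q; a \<in> P \<union> Q; a \<noteq> p; a \<noteq> q\<rbrakk> \<Longrightarrow>
       A p q a - (\<phi> p q + g a q - g a p) \<in> N"
    and \<phi>: "\<And>p q. p \<in> P \<Longrightarrow> q \<in> Q \<Longrightarrow> \<exists>p0\<in>P. \<exists>q0\<in>Q. \<exists>a\<in>P - {p, p0}.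
       \<phi> p q = A p q a - A p0 q a + A p0 q0 a - A p q0 a"
    using four_cycle_exactness[OF N PQ P3 Q3, where A = A and B = B] square by blast
  have square': "B p' p q - B q' p q + A p' q' q - A p' q' p \<in> N"
    if "p \<in> P" "p' \<in> P" "q \<in> Q" "q' \<in> Q" "p \<noteq> p'" "q \<noteq> q'" for p p' q q'
    using sub(3)[OF square[of p' p q' q]] that by (simp add: algebra_simps)
  obtain \<psi> h where \<psi>h: "\<And>p q a. \<lbrakk>p \<in> P; q \<in> Q; a \<in> P \<union> Q; a \<noteq> p; a \<noteq> q\<rbrakk> \<Longrightarrow>
       B a p q - (\<psi> p q + h a q - h a p) \<in> N"
    and \<psi>: "\<And>p q. p \<in> P \<Longrightarrow> q \<in> Q \<Longrightarrow> \<exists>p0\<in>P. \<exists>q0\<in>Q. \<exists>a\<in>P - {p, p0}.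
       \<psi> p q = B a p q - B a p0 q + B a p0 q0 - B a p q0"
    by (rule four_cycle_exactness[OF N PQ P3 Q3, where A = "\<lambda>p q a. B a p q" and B = "\<lambda>a p q. A p q a"])
      (use square' in auto)
  define k where "k x u = g u x - h x u" for x u
  obtain a b where ab: "\<And>x u. \<lbrakk>x \<in> P \<union> Q; u \<in> P \<union> Q; x \<noteq> u\<rbrakk> \<Longrightarrow> k x u - (a u + b x) \<in> N"
  proof (rule mixed_difference_splits[OF N PQ P3 Q3, of k])
    fix p p' q q' assume pq: "p \<in> P" "p' \<in> P" "q \<in> Q" "q' \<in> Q" "p \<noteq> p'" "q \<noteq> q'"
    then have ne: "p \<noteq> q" "p \<noteq> q'" "p' \<noteq> q" "p' \<noteq> q'" using PQ by auto
    let ?X = "\<lambda>a. A p q a - (\<phi> p q + g a q - g a p)"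
    let ?Y = "\<lambda>a. B a p' q' - (\<psi> p' q' + h a q' - h a p')"
    have eq: "k q p' - k p p' - k q q' + k p q' =
        (A p q p' - A p q q' + B q p' q' - B p p' q') - ?X p' + ?X q' - ?Y q + ?Y p"
      by (simp add: k_def algebra_simps)
    show "k q p' - k p p' - k q q' + k p q' \<in> N"
      unfolding eq using pq ne by (intro square \<phi>g \<psi>h sub) auto
  qed blast
  define c where "c = (\<lambda>(x, u). g u x - a u)"
  show thesis
  proof (rule that)
    fix p q x assume pqx: "p \<in> P" "q \<in> Q" "x \<in> P \<union> Q" "x \<noteq> p" "x \<noteq> q"
    show "A p q x - (\<phi> p q + c (q, x) - c (p, x)) \<in> N"
      using \<phi>g[OF pqx] by (simp add: c_def algebra_simps)
    have eq: "B x p q - (\<psi> p q + c (x, q) - c (x, p)) =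
        (B x p q - (\<psi> p q + h x q - h x p)) - (k x q - (a q + b x)) + (k x p - (a p + b x))"
      by (simp add: c_def k_def algebra_simps)
    show "B x p q - (\<psi> p q + c (x, q) - c (x, p)) \<in> N"
      unfolding eq using pqx by (intro \<psi>h ab sub) auto
  qed (rule \<phi>, assumption+, rule \<psi>, assumption+)
qed

section \<open>Singular chains of dimension one\<close>

definition corner :: "nat \<Rightarrow> nat \<Rightarrow> real" where
  "corner i = (\<lambda>j. if j = i then 1 else 0)"

definition point_simplex :: "'a \<Rightarrow> (nat \<Rightarrow> real) \<Rightarrow> 'a" where
  "point_simplex x = (\<lambda>_\<in>standard_simplex 0. x)"

lemma simplical_face_corner:
  "simplical_face k (corner i) = corner (if i < k then i else Suc i)"
  by (auto simp: simplical_face_def corner_def fun_eq_iff)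

lemma corner_in_standard_simplex [simp]: "corner i \<in> standard_simplex p \<longleftrightarrow> i \<le> p"
  by (simp add: corner_def)

lemma singular_face_corner:
  "i \<le> p - Suc 0 \<Longrightarrow> singular_face p k f (corner i) = f (corner (if i < k then i else Suc i))"
  by (simp add: singular_face_def simplical_face_corner)

lemma singular_face_1:
  "singular_face (Suc 0) k f = point_simplex (f (corner (if k = 0 then 1 else 0)))"
proof -
  have "standard_simplex 0 = {corner 0}" by (simp add: standard_simplex_0 corner_def)
  then show ?thesis
    by (intro ext) (auto simp: singular_face_def point_simplex_def simplical_face_corner restrict_def)
qed

lemma chain_boundary_path:
  "chain_boundary 1 (frag_of f) =
     frag_of (point_simplex (f (corner 1))) - frag_of (point_simplex (f (corner 0)))"
  by (simp add: chain_boundary_of singular_face_1)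

lemma chain_boundary_triangle:
  "chain_boundary 2 (frag_of f) =
     frag_of (singular_face 2 0 f) - frag_of (singular_face 2 1 f) + frag_of (singular_face 2 2 f)"
  by (simp add: chain_boundary_of numeral_2_eq_2)

text \<open>
  If each simplex is the coboundary of a global function \<open>G\<close> up to a term \<open>\<eta>\<close>, the contributions of \<open>G\<close>
  cancel along a cycle.
\<close>

lemma cycle_reduces_to_transition_part:
  assumes N: "additive_subgroup N" and keys: "Poly_Mapping.keys c \<subseteq> S"
    and local: "\<And>f. f \<in> S \<Longrightarrow> frag_of f - (G (f (corner 1)) - G (f (corner 0))) - \<eta> f \<in> N"
    and cycle: "chain_boundary 1 c = 0"
  shows "c - frag_extend \<eta> c \<in> N"
proof -
  note sub = additive_subgroupD[OF N]
  define G' where "G' f = G (f (corner 0))" for f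
  have "c - frag_extend G' (chain_boundary 1 c) - frag_extend \<eta> c \<in> N"
    using keys
  proof (induction c rule: frag_induction)
    case zero
    then show ?case using sub by simp
  next
    case (one f)
    have "G' (point_simplex x) = G x" for x by (simp add: G'_def point_simplex_def)
    then show ?case
      using local[OF one] by (simp add: chain_boundary_path frag_extend_diff del: One_nat_def)
  next
    case (diff a b)
    show ?case
      using sub(2)[OF diff]
      by (simp add: chain_boundary_diff frag_extend_diff algebra_simps)
  qed
  then show ?thesis by (simp add: cycle del: One_nat_def)
qed

lemma transition_part_of_boundary:
  assumes keys: "Poly_Mapping.keys d \<subseteq> S"
    and local: "\<And>f. f \<in> S \<Longrightarrow>
      \<eta> (singular_face 2 0 f) - \<eta> (singular_face 2 1 f) + \<eta> (singular_face 2 2 f) = 0"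
  shows "frag_extend \<eta> (chain_boundary 2 d) = 0"
  using keys
proof (induction d rule: frag_induction)
  case (one f)
  then show ?case
    using local by (simp add: chain_boundary_triangle frag_extend_add frag_extend_diff)
qed (auto simp: chain_boundary_diff frag_extend_diff)

lemma additive_subgroup_boundaries: "additive_subgroup (singular_relboundary_set p X S)"
  by (simp add: additive_subgroup_def singular_relboundary_diff)

lemma additive_subgroup_boundaries_plus_cycles:
  "additive_subgroup {b + z | b z. singular_relboundary p X {} b \<and> singular_relcycle p Y {} z}"
  (is "additive_subgroup ?N")
proof -
  have "x - y \<in> ?N" if xy: "x \<in> ?N" "y \<in> ?N" for x y
  proof -
    obtain b z b' z' where "x = b + z" "y = b' + z'" "singular_relboundary p X {} b"
      "singular_relboundary p X {} b'" "singular_relcycle p Y {} z" "singular_relcycle p Y {} z'"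
      using xy by blast
    then have "x - y = (b - b') + (z - z')" "singular_relboundary p X {} (b - b')"
      "singular_relcycle p Y {} (z - z')"
      by (auto simp: algebra_simps singular_relboundary_diff singular_relcycle_diff)
    then show ?thesis by blast
  qed
  moreover have "0 \<in> ?N"
    using singular_relboundary_0 singular_relcycle_0 by (metis (mono_tags, lifting) add_0 mem_Collect_eq)
  ultimately show ?thesis by (simp add: additive_subgroup_def)
qed

lemma boundary_subspace:
  assumes "singular_relboundary p (subtopology X S) {} c" "S \<subseteq> T"
  shows "singular_relboundary p (subtopology X T) {} c"
  using assms singular_boundary_mono by blast

text \<open>
  The contraction makes the cycle homologous to its image under a constant map, and in positive
  degrees every cycle of a one-point space bounds.
\<close>

lemma cycle_in_contractible_is_boundary:
  assumes hom: "homotopic_with (\<lambda>_. True) X X id (\<lambda>_. a)" and a: "a \<in> topspace X"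
    and c: "singular_relcycle p X {} c" and p: "1 \<le> p"
  shows "singular_relboundary p X {} c"
proof -
  have "homotopic_with (\<lambda>h. h \<in> {} \<rightarrow> {}) X X id (\<lambda>_. a)"
    using hom by simp
  then have "homologous_rel p X {} (chain_map p id c) (chain_map p (\<lambda>_. a) c)"
    using homotopic_imp_homologous_rel_chain_maps c by blast
  moreover have "chain_map p id c = c"
    using c chain_map_ident by (auto simp: singular_cycle)
  moreover have "singular_relboundary p X {} (chain_map p (\<lambda>_. a) c)"
  proof -
    have pt: "topspace (subtopology X {a}) = {a}" using a by auto
    have "continuous_map X (subtopology X {a}) (\<lambda>_. a)"
      using a by (simp add: continuous_map_in_subtopology)
    then have "singular_relcycle p (subtopology X {a}) {} (chain_map p (\<lambda>_. a) c)"
      using singular_relcycle_chain_map[OF c, of "subtopology X {a}" "\<lambda>_. a" "{}"] by simp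
    then have "singular_relboundary p (subtopology X {a}) {} (chain_map p (\<lambda>_. a) c)"
      using singular_boundary_eq_cycle_singleton[OF pt p] by simp
    then show ?thesis
      using boundary_subspace[of p X "{a}" _ "topspace X"] a by auto
  qed
  ultimately have "singular_relboundary p X {} (c - chain_map p (\<lambda>_. a) c + chain_map p (\<lambda>_. a) c)"
    unfolding homologous_rel_def by (metis singular_relboundary_add)
  then show ?thesis by simp
qed

lemma iterated_subdivision_homologous:
  assumes "singular_relcycle p X S c"
  shows "homologous_rel p X S ((singular_subdivision p ^^ n) c) c"
proof (induction n)
  case (Suc n)
  have "singular_relcycle p X S ((singular_subdivision p ^^ n) c)"
    using Suc assms homologous_rel_singular_relcycle by blast
  from homologous_rel_singular_subdivision[OF this] Suc show ?case
    using homologous_rel_trans by fastforce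
qed simp

lemma iterated_subdivision_chain:
  "singular_chain p X c \<Longrightarrow> singular_chain p X ((singular_subdivision p ^^ n) c)"
  by (induction n) (auto intro: singular_chain_singular_subdivision)

lemma chain_boundary_iterated_subdivision:
  assumes "singular_chain p X c"
  shows "chain_boundary p ((singular_subdivision p ^^ n) c) =
         (singular_subdivision (p - Suc 0) ^^ n) (chain_boundary p c)"
proof (induction n)
  case (Suc n)
  then show ?case
    using chain_boundary_singular_subdivision[OF iterated_subdivision_chain[OF assms]] by simp
qed simp

text \<open>
  The isomorphism condition on homology groups, unfolded to cycles and boundaries of the two spaces.
\<close>

lemma inclusion_iso_homology:
  assumes sub: "S \<subseteq> T"
    and inj: "\<And>c. singular_relcycle p (subtopology X S) {} c \<Longrightarrow>
       singular_relboundary p (subtopology X T) {} c \<Longrightarrow> singular_relboundary p (subtopology X S) {} c"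
    and surj: "\<And>c. singular_relcycle p (subtopology X T) {} c \<Longrightarrow>
       \<exists>d. singular_relcycle p (subtopology X S) {} d \<and> homologous_rel p (subtopology X T) {} c d"
  shows "hom_induced p (subtopology X S) {} (subtopology X T) {} id
     \<in> iso (homology_group p (subtopology X S)) (homology_group p (subtopology X T))"
proof -
  let ?S = "subtopology X S" and ?T = "subtopology X T"
  let ?h = "hom_induced p ?S {} ?T {} id"
  have cont: "continuous_map ?S ?T id"
    using sub by (auto simp: continuous_map_in_subtopology continuous_map_from_subtopology id_def)
  have on_class: "?h (homologous_rel_set p ?S {} c) = homologous_rel_set p ?T {} c"
    if "singular_relcycle p ?S {} c" for c
    using hom_induced_chain_map[OF cont _ that] that
    by (simp add: chain_map_ident[of p ?S] singular_cycle)
  have cycle_T: "singular_relcycle p ?T {} c" if "singular_relcycle p ?S {} c" for c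
    using that sub singular_cycle_mono by blast
  have "inj_on ?h (carrier (homology_group p ?S))"
  proof (rule inj_onI)
    fix x y assume "x \<in> carrier (homology_group p ?S)" "y \<in> carrier (homology_group p ?S)" and eq: "?h x = ?h y"
    then obtain c d where c: "singular_relcycle p ?S {} c" "x = homologous_rel_set p ?S {} c"
      and d: "singular_relcycle p ?S {} d" "y = homologous_rel_set p ?S {} d"
      unfolding carrier_relative_homology_group by blast
    have "singular_relboundary p ?T {} (c - d)"
      using eq c d on_class by (metis homologous_rel_def homologous_rel_set_eq)
    then have "singular_relboundary p ?S {} (c - d)"
      using inj c d singular_relcycle_diff by blast
    then show "x = y"
      using c d by (metis homologous_rel_def homologous_rel_set_eq)
  qed
  moreover have "?h ` carrier (homology_group p ?S) = carrier (homology_group p ?T)"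
  proof
    show "carrier (homology_group p ?T) \<subseteq> ?h ` carrier (homology_group p ?S)"
    proof
      fix y assume "y \<in> carrier (homology_group p ?T)"
      then obtain c where c: "singular_relcycle p ?T {} c" "y = homologous_rel_set p ?T {} c"
        unfolding carrier_relative_homology_group by blast
      then obtain d where d: "singular_relcycle p ?S {} d" "homologous_rel p ?T {} c d"
        using surj by blast
      then have "y = ?h (homologous_rel_set p ?S {} d)"
        using c on_class by (simp add: homologous_rel_set_eq)
      then show "y \<in> ?h ` carrier (homology_group p ?S)"
        using d unfolding carrier_relative_homology_group by blast
    qed
  qed (use hom_induced_carrier in blast)
  ultimately show ?thesis
    by (simp add: iso_def bij_betw_def hom_induced_hom)
qed

section \<open>Straight simplices between pairs of points\<close>

abbreviation plane :: "(('v \<Rightarrow> real) \<times> ('v \<Rightarrow> real)) topology" where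
  "plane \<equiv> prod_topology (powertop_real UNIV) (powertop_real UNIV)"

definition segment_point :: "('v \<Rightarrow> real) \<times> ('v \<Rightarrow> real) \<Rightarrow> ('v \<Rightarrow> real) \<times> ('v \<Rightarrow> real) \<Rightarrow> real
    \<Rightarrow> ('v \<Rightarrow> real) \<times> ('v \<Rightarrow> real)" where
  "segment_point z z' t = ((\<lambda>v. (1 - t) * fst z v + t * fst z' v), (\<lambda>v. (1 - t) * snd z v + t * snd z' v))"

text \<open>
  On the standard 1-simplex the barycentric coordinate \<open>p 1\<close> is the affine parameter.
\<close>

definition straight :: "('v \<Rightarrow> real) \<times> ('v \<Rightarrow> real) \<Rightarrow> ('v \<Rightarrow> real) \<times> ('v \<Rightarrow> real)
    \<Rightarrow> (nat \<Rightarrow> real) \<Rightarrow> ('v \<Rightarrow> real) \<times> ('v \<Rightarrow> real)" where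
  "straight z z' = (\<lambda>p\<in>standard_simplex 1. segment_point z z' (p 1))"

lemma segment_point_ends [simp]: "segment_point z z' 0 = z" "segment_point z z' 1 = z'"
  by (simp_all add: segment_point_def)

lemma segment_point_reverse: "segment_point z z' t = segment_point z' z (1 - t)"
  by (simp add: segment_point_def algebra_simps)

lemma straight_corners [simp]: "straight z z' (corner 0) = z" "straight z z' (corner (Suc 0)) = z'"
  by (simp_all add: straight_def) (simp_all add: corner_def)

lemma continuous_map_plane:
  "continuous_map X (subtopology plane S) f \<longleftrightarrow>
     (\<forall>v. continuous_map X euclideanreal (\<lambda>x. fst (f x) v)) \<and>
     (\<forall>v. continuous_map X euclideanreal (\<lambda>x. snd (f x) v)) \<and> f \<in> topspace X \<rightarrow> S"
  by (auto simp: continuous_map_in_subtopology continuous_map_pairwise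
      continuous_map_componentwise_UNIV comp_def)

lemma continuous_coordinate:
  "continuous_map (subtopology plane S) euclideanreal (\<lambda>z. fst z v)"
  "continuous_map (subtopology plane S) euclideanreal (\<lambda>z. snd z v)"
  using continuous_map_plane[of "subtopology plane S" S "\<lambda>z. z"] by auto

lemma singular_simplex_straight:
  assumes "\<And>t. 0 \<le> t \<Longrightarrow> t \<le> 1 \<Longrightarrow> segment_point z z' t \<in> S"
  shows "singular_simplex 1 (subtopology plane S) (straight z z')"
proof -
  let ?I = "subtopology (powertop_real UNIV) (standard_simplex 1)"
  have "continuous_map ?I euclideanreal (\<lambda>p. p (1::nat))"
    by (intro continuous_map_from_subtopology continuous_map_product_projection) simp
  then have "continuous_map ?I (subtopology plane S) (\<lambda>p. segment_point z z' (p 1))"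
    unfolding continuous_map_plane
    using assms by (auto simp: segment_point_def standard_simplex_def intro!: continuous_intros)
  then have "continuous_map ?I (subtopology plane S) (straight z z')"
    by (rule continuous_map_eq) (simp add: straight_def)
  then show ?thesis
    by (simp add: singular_simplex_def straight_def del: One_nat_def)
qed

lemma star_shaped_contracts:
  assumes "\<And>z t. z \<in> S \<Longrightarrow> 0 \<le> t \<Longrightarrow> t \<le> 1 \<Longrightarrow> segment_point a z t \<in> S"
  shows "homotopic_with (\<lambda>_. True) (subtopology plane S) (subtopology plane S) id (\<lambda>_. a)"
proof -
  let ?X = "prod_topology (top_of_set {0..1::real}) (subtopology plane S)"
  have t: "continuous_map ?X euclideanreal fst"
    by (metis continuous_map_fst continuous_map_in_subtopology)
  have z: "continuous_map ?X euclideanreal (\<lambda>x. fst (snd x) v)"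
    "continuous_map ?X euclideanreal (\<lambda>x. snd (snd x) v)" for v
    using continuous_map_compose[OF continuous_map_snd continuous_coordinate(1)]
      continuous_map_compose[OF continuous_map_snd continuous_coordinate(2)]
    by (simp_all add: comp_def)
  have "segment_point z a t \<in> S" if "z \<in> S" "0 \<le> t" "t \<le> 1" for z t
    using assms[of z "1 - t"] that by (simp add: segment_point_reverse[of z])
  then have "continuous_map ?X (subtopology plane S) (\<lambda>x. segment_point (snd x) a (fst x))"
    unfolding continuous_map_plane
    by (auto simp: segment_point_def intro!: continuous_intros t z)
  then show ?thesis
    unfolding homotopic_with_def
    by (intro exI[of _ "\<lambda>x. segment_point (snd x) a (fst x)"]) auto
qed

text \<open>
  The path and the two spokes to its end points form a triangle inside a star-shaped set.
\<close>

lemma path_homologous_to_spokes: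
  assumes star: "\<And>z t. z \<in> S \<Longrightarrow> 0 \<le> t \<Longrightarrow> t \<le> 1 \<Longrightarrow> segment_point a z t \<in> S" and a: "a \<in> S"
    and f: "singular_simplex 1 (subtopology plane S) f"
  shows "singular_relboundary 1 (subtopology plane S) {}
     (frag_of f - (frag_of (straight a (f (corner 1))) - frag_of (straight a (f (corner 0)))))"
    (is "singular_relboundary 1 ?S {} ?c")
proof (rule cycle_in_contractible_is_boundary)
  show "homotopic_with (\<lambda>_. True) ?S ?S id (\<lambda>_. a)" using star by (rule star_shaped_contracts)
  have "f (corner i) \<in> S" if "i \<le> 1" for i
    using f that by (auto simp: singular_simplex_def continuous_map_in_subtopology Pi_iff)
  then have "singular_chain 1 ?S ?c"
    using f
    by (intro singular_chain_diff) (auto intro!: singular_simplex_straight star simp: singular_chain_of simp del: One_nat_def split_paired_All)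
  then show "singular_relcycle 1 ?S {} ?c"
    unfolding singular_cycle by (simp add: chain_boundary_diff chain_boundary_path del: One_nat_def) simp
qed (use a in auto)

definition vertex :: "'v \<Rightarrow> 'v \<Rightarrow> real" where
  "vertex v = (\<lambda>w. if w = v then 1 else 0)"

definition vertex_pair :: "'v \<times> 'v \<Rightarrow> ('v \<Rightarrow> real) \<times> ('v \<Rightarrow> real)" where
  "vertex_pair w = (vertex (fst w), vertex (snd w))"

definition spoke :: "'v \<times> 'v \<Rightarrow> ('v \<Rightarrow> real) \<times> ('v \<Rightarrow> real)
    \<Rightarrow> (('v \<Rightarrow> real) \<times> ('v \<Rightarrow> real)) chain" where
  "spoke w z = frag_of (straight (vertex_pair w) z)"

definition midpoint2 :: "'v \<times> 'v \<Rightarrow> 'v \<times> 'v \<Rightarrow> ('v \<Rightarrow> real) \<times> ('v \<Rightarrow> real)" where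
  "midpoint2 w w' = segment_point (vertex_pair w) (vertex_pair w') (1/2)"

text \<open>
  The class of the straight path between two pairs of vertices, broken at its midpoint: in the cases of
  interest each half lies in the cell of its own end, while the whole path lies in neither cell.
\<close>

definition step :: "'v \<times> 'v \<Rightarrow> 'v \<times> 'v \<Rightarrow> (('v \<Rightarrow> real) \<times> ('v \<Rightarrow> real)) chain" where
  "step w w' = spoke w (midpoint2 w w') - spoke w' (midpoint2 w w')"

lemma step_reverse: "step w' w = - step w w'"
proof -
  have "midpoint2 w' w = midpoint2 w w'"
    by (simp add: midpoint2_def segment_point_reverse[of "vertex_pair w'"])
  then show ?thesis by (simp add: step_def)
qed

lemma chain_boundary_spoke:
  "chain_boundary 1 (spoke w z) = frag_of (point_simplex z) - frag_of (point_simplex (vertex_pair w))"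
  by (simp add: spoke_def chain_boundary_path del: One_nat_def) simp

lemma chain_boundary_step:
  "chain_boundary 1 (step w w') =
     frag_of (point_simplex (vertex_pair w')) - frag_of (point_simplex (vertex_pair w))"
  by (simp add: step_def chain_boundary_diff chain_boundary_spoke del: One_nat_def)

text \<open>
  All cells below are cut out by strict inequalities between linear functions, which segments preserve.
\<close>

lemma convex_pos:
  fixes a b t :: real
  assumes "0 \<le> t" "t \<le> 1" "0 < a" "0 < b"
  shows "0 < (1 - t) * a + t * b"
proof (cases "t = 0")
  case False
  then show ?thesis using assms by (intro add_nonneg_pos mult_nonneg_nonneg mult_pos_pos) auto
qed (use assms in auto)

section \<open>The polyhedron of a complete bipartite graph\<close>

locale bipartite =
  fixes P Q :: "'v set"
  assumes finite_PQ: "finite P" "finite Q" and disjoint: "P \<inter> Q = {}"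
    and P3: "\<And>x y. \<exists>z\<in>P. z \<noteq> x \<and> z \<noteq> y" and Q3: "\<And>x y. \<exists>z\<in>Q. z \<noteq> x \<and> z \<noteq> y"
begin

abbreviation "V \<equiv> P \<union> Q"
abbreviation "K \<equiv> complete_bipartite P Q"

definition adjacent :: "'v \<Rightarrow> 'v \<Rightarrow> bool" where
  "adjacent u v \<longleftrightarrow> u \<in> P \<and> v \<in> Q \<or> u \<in> Q \<and> v \<in> P"

lemma adjacentD: "adjacent u v \<Longrightarrow> u \<noteq> v \<and> u \<in> V \<and> v \<in> V"
  using disjoint by (auto simp: adjacent_def)

definition points :: "('v \<Rightarrow> real) set" where
  "points = {x. (\<forall>v. 0 \<le> x v) \<and> {v. x v \<noteq> 0} \<in> K \<and> (\<Sum>v | x v \<noteq> 0. x v) = 1}"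

lemma in_K_iff: "\<sigma> \<in> K \<longleftrightarrow> (\<exists>v\<in>V. \<sigma> = {v}) \<or> (\<exists>u v. adjacent u v \<and> \<sigma> = {u, v})"
proof -
  have "\<sigma> \<in> K \<longleftrightarrow> (\<exists>v\<in>V. \<sigma> = {v}) \<or> (\<exists>u v. u \<in> P \<and> v \<in> Q \<and> \<sigma> = {u, v})"
    unfolding complete_bipartite_def by blast
  moreover have "(\<exists>u v. u \<in> P \<and> v \<in> Q \<and> \<sigma> = {u, v}) \<longleftrightarrow> (\<exists>u v. adjacent u v \<and> \<sigma> = {u, v})"
    unfolding adjacent_def by (metis insert_commute)
  ultimately show ?thesis by simp
qed

lemma K_face: "\<sigma> \<in> K \<Longrightarrow> \<tau> \<subseteq> \<sigma> \<Longrightarrow> \<tau> \<noteq> {} \<Longrightarrow> \<tau> \<in> K"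
proof -
  assume \<sigma>: "\<sigma> \<in> K" and \<tau>: "\<tau> \<subseteq> \<sigma>" "\<tau> \<noteq> {}"
  from \<sigma> consider v where "v \<in> V" "\<sigma> = {v}" | u v where "adjacent u v" "\<sigma> = {u, v}"
    unfolding in_K_iff by blast
  then show "\<tau> \<in> K"
  proof cases
    case 1
    then have "\<tau> = {v}" using \<tau> by blast
    then show ?thesis using 1 by (simp add: in_K_iff)
  next
    case 2
    then consider "\<tau> = {u}" | "\<tau> = {v}" | "\<tau> = {u, v}" using \<tau> by blast
    then show ?thesis using 2 adjacentD[of u v] unfolding in_K_iff by cases blast+
  qed
qed

lemma K_subset: "\<sigma> \<in> K \<Longrightarrow> \<sigma> \<subseteq> V"
  unfolding in_K_iff by (auto dest: adjacentD)

lemma graph_complex_K: "graph_complex K"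
proof -
  obtain p q where "p \<in> P" "q \<in> Q" using P3 Q3 by blast
  then have pq: "adjacent p q" by (simp add: adjacent_def)
  have fin: "finite K" using K_subset finite_PQ by (intro finite_subset[of K "Pow V"]) auto
  have simplex: "finite \<sigma> \<and> \<sigma> \<noteq> {}" "card \<sigma> \<le> 2" if "\<sigma> \<in> K" for \<sigma>
    using that unfolding in_K_iff by (auto simp: card_insert_if)
  have "{p, q} \<in> K" "card {p, q} = 2" using pq adjacentD[OF pq] unfolding in_K_iff by auto
  then have edge: "\<exists>\<sigma>\<in>K. card \<sigma> = 2" by blast
  show ?thesis
    unfolding graph_complex_def
    by (intro conjI ballI allI impI fin edge)
      (auto simp: simplex intro: K_face dest: simplex)
qed

lemma points_iff:
  "x \<in> points \<longleftrightarrow> (\<forall>v. 0 \<le> x v) \<and> {v. x v \<noteq> 0} \<in> K \<and> sum x V = 1"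
proof -
  have "sum x {v. x v \<noteq> 0} = sum x V" if "{v. x v \<noteq> 0} \<in> K"
    using K_subset[OF that] finite_PQ by (intro sum.mono_neutral_left) auto
  then show ?thesis by (auto simp: points_def)
qed

lemma points_nonneg: "x \<in> points \<Longrightarrow> 0 \<le> x v"
  by (simp add: points_def)

lemma points_support: "x \<in> points \<Longrightarrow> {v. 0 < x v} \<in> K"
proof -
  assume "x \<in> points"
  moreover from this have "{v. 0 < x v} = {v. x v \<noteq> 0}" by (auto simp: points_def order.strict_iff_order)
  ultimately show ?thesis by (simp add: points_def)
qed

lemma points_vertex: "x \<in> points \<Longrightarrow> 0 < x v \<Longrightarrow> v \<in> V"
  using K_subset[OF points_support, of x] by auto

lemma points_edge:
  assumes "x \<in> points" "0 < x u" "0 < x v" "u \<noteq> v"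
  shows "adjacent u v" "{w. 0 < x w} = {u, v}"
proof -
  have "{w. 0 < x w} \<noteq> {a}" for a using assms by (metis (mono_tags) mem_Collect_eq singletonD)
  then obtain a b where ab: "adjacent a b" "{w. 0 < x w} = {a, b}"
    using points_support[OF assms(1)] unfolding in_K_iff by blast
  moreover have "u \<in> {a, b}" "v \<in> {a, b}" unfolding ab(2)[symmetric] using assms by auto
  ultimately show "adjacent u v" "{w. 0 < x w} = {u, v}"
    using assms(4) by (auto simp: adjacent_def)
qed

lemma sum_points: "x \<in> points \<Longrightarrow> sum x V = 1"
  by (simp add: points_iff)

lemma points_exists_pos: "x \<in> points \<Longrightarrow> \<exists>v\<in>V. 0 < x v"
  using sum_points[of x] sum_nonpos[of V x] by (force simp: not_less)

lemma vertex_in_points: "v \<in> V \<Longrightarrow> vertex v \<in> points"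
proof -
  assume v: "v \<in> V"
  have "{w. vertex v w \<noteq> 0} = {v}" "\<forall>w. 0 \<le> vertex v w" by (auto simp: vertex_def)
  moreover have "sum (vertex v) V = 1" using v finite_PQ by (simp add: vertex_def)
  moreover have "{v} \<in> K" using v in_K_iff by blast
  ultimately show ?thesis by (simp add: points_iff)
qed

lemma segment_in_points:
  assumes "x \<in> points" "y \<in> points" and K: "{v. 0 < x v} \<union> {v. 0 < y v} \<in> K" and t: "0 \<le> t" "t \<le> 1"
  shows "(\<lambda>v. (1 - t) * x v + t * y v) \<in> points" (is "?z \<in> _")
proof -
  have nonneg: "0 \<le> ?z v" for v using assms points_nonneg by simp
  have sum: "sum ?z V = 1"
    using assms sum_points by (simp add: sum.distrib flip: sum_distrib_left)
  have "{v. ?z v \<noteq> 0} \<subseteq> {v. 0 < x v} \<union> {v. 0 < y v}"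
    using points_nonneg[OF assms(1)] points_nonneg[OF assms(2)]
    by (auto simp: order.strict_iff_order)
  moreover have "{v. ?z v \<noteq> 0} \<noteq> {}"
  proof
    assume "{v. ?z v \<noteq> 0} = {}"
    then have "?z v = 0" for v by (metis (mono_tags, lifting) empty_Collect_eq)
    then show False using sum by simp
  qed
  ultimately have "{v. ?z v \<noteq> 0} \<in> K" using K_face[OF K] by blast
  then show ?thesis using nonneg sum by (simp add: points_iff)
qed

section \<open>Star-shaped cells and the steps between them\<close>

abbreviation "square \<equiv> points \<times> points"

text \<open>
  The parameter \<open>e\<close> treats the two spaces at once: \<open>e = 0\<close> stands for the product, whose cells are
  indexed by all pairs of vertices, and \<open>e = 1\<close> for the configuration space, whose cells are indexed by
  pairs of distinct vertices.
\<close>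

definition valid :: "real \<Rightarrow> 'v \<times> 'v \<Rightarrow> bool" where
  "valid e w \<longleftrightarrow> e \<in> {0, 1} \<and> w \<in> V \<times> V \<and> (e = 1 \<longrightarrow> fst w \<noteq> snd w)"

text \<open>
  For \<open>e = 0\<close> this is the product of the open stars of \<open>u\<close> and \<open>v\<close>; for \<open>e = 1\<close> the first point is nearer
  to \<open>u\<close> than the second, and conversely for \<open>v\<close>, which keeps the points apart.
\<close>

definition cell :: "real \<Rightarrow> 'v \<times> 'v \<Rightarrow> (('v \<Rightarrow> real) \<times> ('v \<Rightarrow> real)) set" where
  "cell e w = {z \<in> square. e * snd z (fst w) < fst z (fst w) \<and> e * fst z (snd w) < snd z (snd w)}"

definition pairs :: "real \<Rightarrow> (('v \<Rightarrow> real) \<times> ('v \<Rightarrow> real)) set" where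
  "pairs e = {z \<in> square. e = 1 \<longrightarrow> fst z \<noteq> snd z}"

abbreviation pair_space :: "real \<Rightarrow> (('v \<Rightarrow> real) \<times> ('v \<Rightarrow> real)) topology" where
  "pair_space e \<equiv> subtopology plane (pairs e)"

definition boundaries :: "real \<Rightarrow> (('v \<Rightarrow> real) \<times> ('v \<Rightarrow> real)) chain set" where
  "boundaries e = singular_relboundary_set 1 (pair_space e) {}"

lemma additive_subgroup_boundaries_pairs: "additive_subgroup (boundaries e)"
  unfolding boundaries_def by (rule additive_subgroup_boundaries)

lemma cell_pos:
  assumes "valid e w" "z \<in> cell e w"
  shows "0 < fst z (fst w)" "0 < snd z (snd w)"
proof -
  have "0 \<le> e * snd z (fst w)" "0 \<le> e * fst z (snd w)"
    using assms by (auto simp: valid_def cell_def points_nonneg)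
  then show "0 < fst z (fst w)" "0 < snd z (snd w)"
    using assms by (auto simp: cell_def)
qed

lemma cell_subset_pairs: "cell e w \<subseteq> pairs e"
  by (auto simp: cell_def pairs_def)

lemma vertex_pair_in_square: "valid e w \<Longrightarrow> vertex_pair w \<in> square"
  by (auto simp: valid_def vertex_pair_def intro: vertex_in_points)

lemma vertex_pair_in_cell: "valid e w \<Longrightarrow> vertex_pair w \<in> cell e w"
  using vertex_pair_in_square[of e w] by (auto simp: valid_def vertex_pair_def cell_def vertex_def)

lemma segment_in_square:
  assumes "z \<in> square" "z' \<in> square" "0 \<le> t" "t \<le> 1"
    and "{v. 0 < fst z v} \<union> {v. 0 < fst z' v} \<in> K" "{v. 0 < snd z v} \<union> {v. 0 < snd z' v} \<in> K"
  shows "segment_point z z' t \<in> square"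
  using assms segment_in_points by (auto simp: segment_point_def)

lemma segment_in_cell:
  assumes "z \<in> cell e w" "z' \<in> cell e w" "segment_point z z' t \<in> square" "0 \<le> t" "t \<le> 1"
  shows "segment_point z z' t \<in> cell e w"
proof -
  have "0 < (1 - t) * (fst z (fst w) - e * snd z (fst w)) + t * (fst z' (fst w) - e * snd z' (fst w))"
    "0 < (1 - t) * (snd z (snd w) - e * fst z (snd w)) + t * (snd z' (snd w) - e * fst z' (snd w))"
    using assms by (auto intro!: convex_pos simp: cell_def)
  then show ?thesis
    using assms(3) by (simp add: cell_def segment_point_def algebra_simps)
qed

lemma vertex_support: "{v. 0 < vertex u v} = {u}"
  by (auto simp: vertex_def)

lemma cell_star_shaped:
  assumes w: "valid e w" and z: "z \<in> cell e w" and t: "0 \<le> t" "t \<le> 1"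
  shows "segment_point (vertex_pair w) z t \<in> cell e w"
proof -
  have "z \<in> square" using z by (simp add: cell_def)
  then have "{v. 0 < fst z v} \<in> K" "{v. 0 < snd z v} \<in> K" using points_support by auto
  moreover have "insert (fst w) {v. 0 < fst z v} = {v. 0 < fst z v}"
    "insert (snd w) {v. 0 < snd z v} = {v. 0 < snd z v}"
    using cell_pos[OF w z] by auto
  ultimately have "segment_point (vertex_pair w) z t \<in> square"
    using \<open>z \<in> square\<close> t vertex_pair_in_square[OF w]
    by (intro segment_in_square) (auto simp: vertex_pair_def vertex_support)
  then show ?thesis using segment_in_cell[OF vertex_pair_in_cell[OF w] z _ t] by simp
qed

lemma open_cell: "openin (pair_space e) (cell e w)"
proof -
  let ?f = "\<lambda>z. fst z (fst w) - e * snd z (fst w)" and ?g = "\<lambda>z. snd z (snd w) - e * fst z (snd w)"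
  have f: "continuous_map (pair_space e) euclideanreal ?f" and g: "continuous_map (pair_space e) euclideanreal ?g"
    by (intro continuous_intros continuous_coordinate)+
  have open_f: "openin (pair_space e) {z \<in> topspace (pair_space e). ?f z \<in> {0<..}}"
    by (rule openin_continuous_map_preimage[OF f]) simp
  have open_g: "openin (pair_space e) {z \<in> topspace (pair_space e). ?g z \<in> {0<..}}"
    by (rule openin_continuous_map_preimage[OF g]) simp
  have eq: "cell e w = {z \<in> topspace (pair_space e). ?f z \<in> {0<..}} \<inter>
      {z \<in> topspace (pair_space e). ?g z \<in> {0<..}}"
    using cell_subset_pairs[of e w] by (auto simp: cell_def pairs_def)
  show ?thesis unfolding eq by (rule openin_Int[OF open_f open_g])
qed

text \<open>
  Otherwise one coordinate vector would be dominated by the other, with a strict inequality somewhere,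
  although both have sum one.
\<close>

lemma exists_larger_coordinate:
  assumes "x \<in> points" "y \<in> points" "x \<noteq> y"
  shows "\<exists>v\<in>V. y v < x v"
proof (rule ccontr)
  assume "\<not> ?thesis"
  then have le: "x v \<le> y v" if "v \<in> V" for v using that by force
  have "\<exists>v\<in>V. x v \<noteq> y v"
  proof (rule ccontr)
    assume "\<not> ?thesis"
    moreover have "x v = 0 \<and> y v = 0" if "v \<notin> V" for v
      using that points_vertex[OF assms(1), of v] points_vertex[OF assms(2), of v]
        points_nonneg[OF assms(1), of v] points_nonneg[OF assms(2), of v] by linarith
    ultimately have "x v = y v" for v by metis
    then show False using assms(3) by blast
  qed
  then have "\<exists>v\<in>V. x v < y v" using le by force
  then have "sum x V < sum y V" using le finite_PQ by (intro sum_strict_mono_ex1) auto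
  then show False using assms sum_points by simp
qed

lemma cells_cover:
  assumes e: "e \<in> {0, 1}" and z: "z \<in> pairs e"
  shows "\<exists>w. valid e w \<and> z \<in> cell e w"
proof (cases "e = 0")
  case True
  have "fst z \<in> points" "snd z \<in> points" using z by (auto simp: pairs_def)
  then obtain u v where "u \<in> V" "0 < fst z u" "v \<in> V" "0 < snd z v"
    using points_exists_pos by meson
  then show ?thesis
    using z True by (intro exI[of _ "(u, v)"]) (auto simp: valid_def cell_def pairs_def)
next
  case False
  then have points: "fst z \<in> points" "snd z \<in> points" "fst z \<noteq> snd z" using z e by (auto simp: pairs_def)
  obtain u where "u \<in> V" "snd z u < fst z u"
    using exists_larger_coordinate[OF points] by blast
  moreover obtain v where "v \<in> V" "fst z v < snd z v"
    using exists_larger_coordinate[OF points(2,1) points(3)[symmetric]] by blast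
  ultimately obtain u v where "u \<in> V" "snd z u < fst z u" "v \<in> V" "fst z v < snd z v"
    by blast
  then show ?thesis
    using z e False by (intro exI[of _ "(u, v)"]) (auto simp: valid_def cell_def pairs_def)
qed

lemma midpoint2_coordinates:
  "fst (midpoint2 w w') a = (if a = fst w then 1/2 else 0) + (if a = fst w' then 1/2 else 0)"
  "snd (midpoint2 w w') a = (if a = snd w then 1/2 else 0) + (if a = snd w' then 1/2 else 0)"
  by (simp_all add: midpoint2_def segment_point_def vertex_pair_def vertex_def)

lemma midpoint2_support:
  "{a. 0 < fst (midpoint2 w w') a} = {fst w, fst w'}" "{a. 0 < snd (midpoint2 w w') a} = {snd w, snd w'}"
  by (auto simp: midpoint2_coordinates)

lemma midpoint2_in_square:
  assumes "valid e w" "valid e w'" "{fst w, fst w'} \<in> K" "{snd w, snd w'} \<in> K"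
  shows "midpoint2 w w' \<in> square"
  unfolding midpoint2_def
  using assms by (intro segment_in_square)
    (auto simp: vertex_pair_def vertex_support insert_commute vertex_in_points valid_def)

text \<open>
  For \<open>e = 1\<close> the two edges have to be disjoint: then the coordinates of either point of the midpoint
  vanish at the vertices of the edge that contains the other point.
\<close>

lemma midpoint2_in_cell:
  assumes "valid e w" "valid e w'" "{fst w, fst w'} \<in> K" "{snd w, snd w'} \<in> K"
    and "u \<in> {fst w, fst w'}" "v \<in> {snd w, snd w'}"
    and "e = 1 \<Longrightarrow> {fst w, fst w'} \<inter> {snd w, snd w'} = {}"
  shows "midpoint2 w w' \<in> cell e (u, v)"
proof (cases "e = 0")
  case True
  have "u \<in> {a. 0 < fst (midpoint2 w w') a}" "v \<in> {a. 0 < snd (midpoint2 w w') a}"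
    using assms(5,6) unfolding midpoint2_support by auto
  then show ?thesis
    using midpoint2_in_square[OF assms(1-4)] True by (simp add: cell_def)
next
  case False
  then have e: "e = 1" using assms(1) by (auto simp: valid_def)
  then have "u \<in> {a. 0 < fst (midpoint2 w w') a}" "v \<in> {a. 0 < snd (midpoint2 w w') a}"
    "u \<notin> {snd w, snd w'}" "v \<notin> {fst w, fst w'}"
    using assms(5-7) unfolding midpoint2_support by auto
  moreover from this have "snd (midpoint2 w w') u = 0" "fst (midpoint2 w w') v = 0"
    by (auto simp: midpoint2_coordinates)
  ultimately show ?thesis
    using midpoint2_in_square[OF assms(1-4)] e by (simp add: cell_def)
qed

lemma path_in_cell:
  assumes w: "valid e w" and f: "singular_simplex 1 (subtopology plane (cell e w)) f"
  shows "frag_of f - (spoke w (f (corner 1)) - spoke w (f (corner 0))) \<in> boundaries e"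
  using boundary_subspace[OF path_homologous_to_spokes[OF cell_star_shaped[OF w] vertex_pair_in_cell[OF w] f]
      cell_subset_pairs]
  by (simp add: boundaries_def spoke_def)

text \<open>
  In an overlap, the carrier of each of the two points contains both vertices that the cells assign to
  that point.  This is why indices of overlapping cells differ by moves along edges only.
\<close>

lemma overlap_supports:
  assumes "valid e w" "valid e w'" and z: "z \<in> cell e w" "z \<in> cell e w'"
  shows "{fst w, fst w'} \<subseteq> {v. 0 < fst z v}" "{snd w, snd w'} \<subseteq> {v. 0 < snd z v}"
    "{v. 0 < fst z v} \<in> K" "{v. 0 < snd z v} \<in> K"
    "{fst w, fst w'} \<in> K" "{snd w, snd w'} \<in> K"
    "e = 1 \<Longrightarrow> {fst w, fst w'} \<inter> {snd w, snd w'} = {}"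
proof -
  show 1: "{fst w, fst w'} \<subseteq> {v. 0 < fst z v}" "{snd w, snd w'} \<subseteq> {v. 0 < snd z v}"
    using cell_pos assms by auto
  show 2: "{v. 0 < fst z v} \<in> K" "{v. 0 < snd z v} \<in> K"
    using z points_support by (auto simp: cell_def)
  show "{fst w, fst w'} \<in> K" "{snd w, snd w'} \<in> K"
    using K_face[OF 2(1) 1(1)] K_face[OF 2(2) 1(2)] by auto
  show "{fst w, fst w'} \<inter> {snd w, snd w'} = {}" if "e = 1"
    using z that by (auto simp: cell_def)
qed

text \<open>
  The segment from \<open>z\<close> to the midpoint lies in both cells, hence equals a difference of spokes in two
  ways.
\<close>

lemma spoke_difference:
  assumes w: "valid e w" "valid e w'" and z: "z \<in> cell e w" "z \<in> cell e w'"
  shows "spoke w z - spoke w' z - step w w' \<in> boundaries e"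
proof -
  note supp = overlap_supports[OF w z]
  let ?m = "midpoint2 w w'"
  have m: "?m \<in> cell e w" "?m \<in> cell e w'"
    using midpoint2_in_cell[OF w supp(5,6) _ _ supp(7), of "fst w" "snd w"]
      midpoint2_in_cell[OF w supp(5,6) _ _ supp(7), of "fst w'" "snd w'"] by auto
  have sq: "segment_point z ?m t \<in> square" if t: "0 \<le> t" "t \<le> 1" for t
  proof (rule segment_in_square)
    show "{v. 0 < fst z v} \<union> {v. 0 < fst ?m v} \<in> K" "{v. 0 < snd z v} \<union> {v. 0 < snd ?m v} \<in> K"
      unfolding midpoint2_support Un_absorb2[OF supp(1)] Un_absorb2[OF supp(2)] by (rule supp)+
  qed (use m z t in \<open>auto simp: cell_def\<close>)
  have path: "singular_simplex 1 (subtopology plane (cell e u)) (straight z ?m)"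
    if "z \<in> cell e u" "?m \<in> cell e u" for u
    using that sq by (intro singular_simplex_straight segment_in_cell) auto
  have "frag_of (straight z ?m) - (spoke w ?m - spoke w z) \<in> boundaries e"
    and "frag_of (straight z ?m) - (spoke w' ?m - spoke w' z) \<in> boundaries e"
    using path_in_cell[OF w(1) path] path_in_cell[OF w(2) path] m z by auto
  from additive_subgroupD(2)[OF additive_subgroup_boundaries_pairs this] show ?thesis
    by (simp add: step_def algebra_simps)
qed

lemma step_cocycle:
  assumes "valid e w" "valid e w'" "valid e w''" "z \<in> cell e w" "z \<in> cell e w'" "z \<in> cell e w''"
  shows "step w w' + step w' w'' - step w w'' \<in> boundaries e"
proof -
  have eq: "step w w' + step w' w'' - step w w'' = (spoke w z - spoke w'' z - step w w'')
     - (spoke w z - spoke w' z - step w w') - (spoke w' z - spoke w'' z - step w' w'')"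
    by (simp add: algebra_simps)
  show ?thesis
    unfolding eq using assms
    by (intro spoke_difference additive_subgroupD(2)[OF additive_subgroup_boundaries_pairs])
qed

lemma adjacent_in_K: "adjacent u v \<Longrightarrow> {u, v} \<in> K"
  by (auto simp: in_K_iff)

text \<open>
  The midpoint of the product of the two edges lies in all four cells, so by the cocycle rule both ways
  around the square agree with the diagonal step.
\<close>

lemma step_square:
  assumes xy: "adjacent x y" and uv: "adjacent u v" and e: "e \<in> {0, 1}"
    and disj: "e = 1 \<Longrightarrow> {x, y} \<inter> {u, v} = {}"
  shows "step (x, u) (y, u) + step (y, u) (y, v) - step (x, u) (x, v) - step (x, v) (y, v) \<in> boundaries e"
proof -
  have valid: "valid e (a, b)" if "a \<in> {x, y}" "b \<in> {u, v}" for a b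
    using that adjacentD[OF xy] adjacentD[OF uv] e disj by (auto simp: valid_def)
  have cell: "midpoint2 (x, u) (y, v) \<in> cell e (a, b)" if "a \<in> {x, y}" "b \<in> {u, v}" for a b
    using that disj adjacent_in_K[OF xy] adjacent_in_K[OF uv]
    by (intro midpoint2_in_cell valid) auto
  have "(step (x, u) (y, u) + step (y, u) (y, v) - step (x, u) (y, v)) -
      (step (x, u) (x, v) + step (x, v) (y, v) - step (x, u) (y, v)) \<in> boundaries e"
    by (intro additive_subgroupD(2)[OF additive_subgroup_boundaries_pairs]
      step_cocycle[where z = "midpoint2 (x, u) (y, v)"] valid cell) auto
  then show ?thesis by (simp add: algebra_simps)
qed

lemma singular_chain_step:
  assumes w: "valid e w" "valid e w'" and z: "z \<in> cell e w" "z \<in> cell e w'"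
  shows "singular_chain 1 (pair_space e) (step w w')"
proof -
  note supp = overlap_supports[OF w z]
  have m: "midpoint2 w w' \<in> cell e w" "midpoint2 w w' \<in> cell e w'"
    using midpoint2_in_cell[OF w supp(5,6) _ _ supp(7), of "fst w" "snd w"]
      midpoint2_in_cell[OF w supp(5,6) _ _ supp(7), of "fst w'" "snd w'"] by auto
  have "singular_simplex 1 (pair_space e) (straight (vertex_pair u) (midpoint2 w w'))"
    if "valid e u" "midpoint2 w w' \<in> cell e u" for u
    using cell_star_shaped[OF that] cell_subset_pairs by (intro singular_simplex_straight) blast
  then show ?thesis
    unfolding step_def spoke_def using m w
    by (intro singular_chain_diff) (simp_all add: singular_chain_of del: One_nat_def)
qed

section \<open>Splitting of steps and the height function\<close>

lemma valid_mono: "valid e w \<Longrightarrow> valid 0 w"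
  by (simp add: valid_def)

lemma cell_mono:
  assumes "valid e w"
  shows "cell e w \<subseteq> cell 0 w"
proof
  fix z assume z: "z \<in> cell e w"
  then show "z \<in> cell 0 w" using cell_pos[OF assms z] by (simp add: cell_def)
qed

lemma pairs_mono: "pairs e \<subseteq> pairs 0"
  by (auto simp: pairs_def)

lemma singular_chain_step_edge:
  assumes "valid e w" "valid e w'" "{fst w, fst w'} \<in> K" "{snd w, snd w'} \<in> K"
    and "e = 1 \<Longrightarrow> {fst w, fst w'} \<inter> {snd w, snd w'} = {}"
  shows "singular_chain 1 (pair_space e) (step w w')"
  using singular_chain_step[OF assms(1,2)] midpoint2_in_cell[OF assms(1-4) _ _ assms(5), of "fst w" "snd w"]
    midpoint2_in_cell[OF assms(1-4) _ _ assms(5), of "fst w'" "snd w'"] by simp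

text \<open>
  The antisymmetric extension to both orientations of each edge, zero elsewhere.
\<close>

definition orient :: "('v \<Rightarrow> 'v \<Rightarrow> 'b::ab_group_add) \<Rightarrow> 'v \<Rightarrow> 'v \<Rightarrow> 'b" where
  "orient \<phi> x y = (if x \<in> P \<and> y \<in> Q then \<phi> x y else if x \<in> Q \<and> y \<in> P then - \<phi> y x else 0)"

lemma orient_antisym: "orient \<phi> y x = - orient \<phi> x y"
  using disjoint by (auto simp: orient_def)

lemma orient_refl [simp]: "orient \<phi> x x = 0"
  using disjoint by (auto simp: orient_def)

text \<open>
  The values of \<open>\<phi>\<close> and \<open>\<psi>\<close> are sums of steps around closed 4-cycles in the configuration space; that
  they are cycles is what makes them disappear in the surjectivity argument.
\<close>

lemma step_splits:
  obtains \<phi> c \<psi> where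
    "\<And>x y a. adjacent x y \<Longrightarrow> a \<in> V \<Longrightarrow> a \<noteq> x \<Longrightarrow> a \<noteq> y \<Longrightarrow>
       step (x, a) (y, a) - (orient \<phi> x y + c (y, a) - c (x, a)) \<in> boundaries 1"
    "\<And>x y a. adjacent x y \<Longrightarrow> a \<in> V \<Longrightarrow> a \<noteq> x \<Longrightarrow> a \<noteq> y \<Longrightarrow>
       step (a, x) (a, y) - (orient \<psi> x y + c (a, y) - c (a, x)) \<in> boundaries 1"
    "\<And>x y. singular_relcycle 1 (pair_space 1) {} (orient \<phi> x y)"
    "\<And>x y. singular_relcycle 1 (pair_space 1) {} (orient \<psi> x y)"
proof -
  note N = additive_subgroup_boundaries_pairs[of 1]
  have square: "step (p, p') (q, p') - step (p, q') (q, q') + step (q, p') (q, q') - step (p, p') (p, q')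
      \<in> boundaries 1"
    if "p \<in> P" "p' \<in> P" "q \<in> Q" "q' \<in> Q" "p \<noteq> p'" "q \<noteq> q'" for p p' q q'
  proof -
    have "{p, q} \<inter> {p', q'} = {}" using that disjoint by auto
    then have "step (p, p') (q, p') + step (q, p') (q, q') - step (p, p') (p, q') - step (p, q') (q, q') \<in> boundaries 1"
      using that by (intro step_square) (auto simp: adjacent_def)
    then show ?thesis by (simp add: algebra_simps)
  qed
  obtain \<phi> \<psi> c where A: "\<And>p q a. \<lbrakk>p \<in> P; q \<in> Q; a \<in> P \<union> Q; a \<noteq> p; a \<noteq> q\<rbrakk> \<Longrightarrow>
       step (p, a) (q, a) - (\<phi> p q + c (q, a) - c (p, a)) \<in> boundaries 1"
    and B: "\<And>p q a. \<lbrakk>p \<in> P; q \<in> Q; a \<in> P \<union> Q; a \<noteq> p; a \<noteq> q\<rbrakk> \<Longrightarrow>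
       step (a, p) (a, q) - (\<psi> p q + c (a, q) - c (a, p)) \<in> boundaries 1"
    and \<phi>: "\<And>p q. p \<in> P \<Longrightarrow> q \<in> Q \<Longrightarrow> \<exists>p0\<in>P. \<exists>q0\<in>Q. \<exists>a\<in>P - {p, p0}.
       \<phi> p q = step (p, a) (q, a) - step (p0, a) (q, a) + step (p0, a) (q0, a) - step (p, a) (q0, a)"
    and \<psi>: "\<And>p q. p \<in> P \<Longrightarrow> q \<in> Q \<Longrightarrow> \<exists>p0\<in>P. \<exists>q0\<in>Q. \<exists>a\<in>P - {p, p0}.
       \<psi> p q = step (a, p) (a, q) - step (a, p0) (a, q) + step (a, p0) (a, q0) - step (a, p) (a, q0)"
    by (rule grid_cocycle_splits[OF N disjoint P3 Q3,
        where A = "\<lambda>p q a. step (p, a) (q, a)" and B = "\<lambda>a p q. step (a, p) (a, q)"])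
      (use square in auto)
  have chain: "singular_chain 1 (pair_space 1) (step (p, a) (q, a))"
    "singular_chain 1 (pair_space 1) (step (a, p) (a, q))"
    if "p \<in> P" "q \<in> Q" "a \<in> P" "a \<noteq> p" for p q a
  proof -
    have "a \<noteq> q" "{p, q} \<in> K" "{a} \<in> K" using that disjoint by (auto simp: in_K_iff adjacent_def)
    then show "singular_chain 1 (pair_space 1) (step (p, a) (q, a))"
      "singular_chain 1 (pair_space 1) (step (a, p) (a, q))"
      using that by (auto intro!: singular_chain_step_edge simp: valid_def simp del: One_nat_def)
  qed
  have cyc_\<phi>: "singular_relcycle 1 (pair_space 1) {} (\<phi> p q)" if pq: "p \<in> P" "q \<in> Q" for p q
  proof -
    obtain p0 q0 a where "p0 \<in> P" "q0 \<in> Q" "a \<in> P" "a \<noteq> p" "a \<noteq> p0" and eq: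
      "\<phi> p q = step (p, a) (q, a) - step (p0, a) (q, a) + step (p0, a) (q0, a) - step (p, a) (q0, a)"
      using \<phi>[OF pq] by blast
    then show ?thesis
      unfolding singular_cycle eq using pq
      by (auto intro!: singular_chain_diff singular_chain_add chain
          simp: chain_boundary_diff chain_boundary_add chain_boundary_step simp del: One_nat_def)
  qed
  have cyc_\<psi>: "singular_relcycle 1 (pair_space 1) {} (\<psi> p q)" if pq: "p \<in> P" "q \<in> Q" for p q
  proof -
    obtain p0 q0 a where "p0 \<in> P" "q0 \<in> Q" "a \<in> P" "a \<noteq> p" "a \<noteq> p0" and eq:
      "\<psi> p q = step (a, p) (a, q) - step (a, p0) (a, q) + step (a, p0) (a, q0) - step (a, p) (a, q0)"
      using \<psi>[OF pq] by blast
    then show ?thesis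
      unfolding singular_cycle eq using pq
      by (auto intro!: singular_chain_diff singular_chain_add chain
          simp: chain_boundary_diff chain_boundary_add chain_boundary_step simp del: One_nat_def)
  qed
  show thesis
  proof (rule that)
    fix x y a assume xya: "adjacent x y" "a \<in> V" "a \<noteq> x" "a \<noteq> y"
    show "step (x, a) (y, a) - (orient \<phi> x y + c (y, a) - c (x, a)) \<in> boundaries 1"
    proof (cases "x \<in> P")
      case True
      then show ?thesis using A[of x y a] xya disjoint by (auto simp: adjacent_def orient_def)
    next
      case False
      then have "y \<in> P" "x \<in> Q" using xya by (auto simp: adjacent_def)
      then have "step (y, a) (x, a) - (orient \<phi> y x + c (x, a) - c (y, a)) \<in> boundaries 1"
        using A[of y x a] xya by (simp add: orient_def)
      from additive_subgroupD(3)[OF N this] show ?thesis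
        by (simp add: step_reverse[of "(x, a)"] orient_antisym[of _ y x] algebra_simps)
    qed
    show "step (a, x) (a, y) - (orient \<psi> x y + c (a, y) - c (a, x)) \<in> boundaries 1"
    proof (cases "x \<in> P")
      case True
      then show ?thesis using B[of x y a] xya disjoint by (auto simp: adjacent_def orient_def)
    next
      case False
      then have "y \<in> P" "x \<in> Q" using xya by (auto simp: adjacent_def)
      then have "step (a, y) (a, x) - (orient \<psi> y x + c (a, x) - c (a, y)) \<in> boundaries 1"
        using B[of y x a] xya by (simp add: orient_def)
      from additive_subgroupD(3)[OF N this] show ?thesis
        by (simp add: step_reverse[of "(a, x)"] orient_antisym[of _ y x] algebra_simps)
    qed
  next
    fix x y
    show "singular_relcycle 1 (pair_space 1) {} (orient \<phi> x y)" "singular_relcycle 1 (pair_space 1) {} (orient \<psi> x y)"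
      using cyc_\<phi> cyc_\<psi> by (auto simp: orient_def singular_relcycle_minus simp del: One_nat_def)
  qed
qed

definition nearby :: "('v \<Rightarrow> real) \<Rightarrow> 'v" where
  "nearby x = (SOME v. 0 < x v)"

text \<open>
  The potential, on the cell of \<open>w\<close>, of the cocycle on the product that takes the values \<open>\<phi>\<close> and \<open>\<psi>\<close> on
  edges; \<open>nearby\<close> discretizes the points.
\<close>

definition height where
  "height \<phi> \<psi> w z = orient \<phi> (fst w) (nearby (fst z)) + orient \<psi> (snd w) (nearby (snd z))"

text \<open>
  The choice of the cell is immaterial by \<open>height_change_eq\<close>.
\<close>

definition height_change where
  "height_change \<phi> \<psi> f = (let w = SOME w. valid 0 w \<and> f \<in> standard_simplex 1 \<rightarrow> cell 0 w
     in height \<phi> \<psi> w (f (corner 1)) - height \<phi> \<psi> w (f (corner 0)))"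

text \<open>
  A point in the open stars of two vertices lies on their edge, so its nearby vertex is one of the
  two.
\<close>

lemma orient_nearby:
  assumes "x \<in> points" "0 < x u" "0 < x u'"
  shows "orient \<phi> u (nearby x) - orient \<phi> u' (nearby x) = orient \<phi> u u'"
proof (cases "u = u'")
  case False
  have "0 < x (nearby x)" unfolding nearby_def using assms(2) by (rule someI)
  then have "nearby x \<in> {u, u'}" using points_edge(2)[OF assms False] by blast
  then show ?thesis using orient_antisym[of \<phi> u u'] by auto
qed simp

lemma height_difference:
  assumes "valid e w" "valid e w'" "z \<in> cell e w" "z \<in> cell e w'"
  shows "height \<phi> \<psi> w z - height \<phi> \<psi> w' z = orient \<phi> (fst w) (fst w') + orient \<psi> (snd w) (snd w')"
proof -
  have "fst z \<in> points" "snd z \<in> points" using assms by (auto simp: cell_def)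
  then have "orient \<phi> (fst w) (nearby (fst z)) - orient \<phi> (fst w') (nearby (fst z)) = orient \<phi> (fst w) (fst w')"
    "orient \<psi> (snd w) (nearby (snd z)) - orient \<psi> (snd w') (nearby (snd z)) = orient \<psi> (snd w) (snd w')"
    using cell_pos[OF assms(1,3)] cell_pos[OF assms(2,4)] by (auto intro!: orient_nearby)
  then show ?thesis by (simp add: height_def algebra_simps)
qed

lemma height_change_eq:
  assumes "valid 0 w" "f \<in> standard_simplex 1 \<rightarrow> cell 0 w"
  shows "height_change \<phi> \<psi> f = height \<phi> \<psi> w (f (corner 1)) - height \<phi> \<psi> w (f (corner 0))"
proof -
  define w' where "w' = (SOME w. valid 0 w \<and> f \<in> standard_simplex 1 \<rightarrow> cell 0 w)"
  have w': "valid 0 w'" "f \<in> standard_simplex 1 \<rightarrow> cell 0 w'"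
    unfolding w'_def using someI[of "\<lambda>w. valid 0 w \<and> f \<in> standard_simplex 1 \<rightarrow> cell 0 w"] assms by blast+
  have mem: "f (corner i) \<in> cell 0 w" "f (corner i) \<in> cell 0 w'" if "i \<le> 1" for i
    using assms w' that by (auto simp: Pi_iff)
  have "height \<phi> \<psi> w (f (corner i)) - height \<phi> \<psi> w' (f (corner i)) = orient \<phi> (fst w) (fst w') + orient \<psi> (snd w) (snd w')"
    if "i \<le> 1" for i
    using height_difference[OF assms(1) w'(1)] mem[OF that] by blast
  from this[of 0] this[of 1] show ?thesis
    unfolding height_change_def w'_def[symmetric] Let_def by (simp add: algebra_simps)
qed

text \<open>
  A diagonal transition is composed of a vertical and a horizontal one; the intermediate cell also
  contains \<open>z\<close>.
\<close>

lemma step_transition: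
  assumes N: "additive_subgroup N" and BN: "boundaries e \<subseteq> N"
    and horizontal: "\<And>x y a. adjacent x y \<Longrightarrow> valid e (x, a) \<Longrightarrow> valid e (y, a) \<Longrightarrow>
       step (x, a) (y, a) - (orient \<phi> x y + c (y, a) - c (x, a)) \<in> N"
    and vertical: "\<And>x y a. adjacent x y \<Longrightarrow> valid e (a, x) \<Longrightarrow> valid e (a, y) \<Longrightarrow>
       step (a, x) (a, y) - (orient \<psi> x y + c (a, y) - c (a, x)) \<in> N"
    and w: "valid e w" "valid e w'" and z: "z \<in> cell e w" "z \<in> cell e w'"
  shows "step w w' - (orient \<phi> (fst w) (fst w') + orient \<psi> (snd w) (snd w') + c w' - c w) \<in> N"
proof -
  note sub = additive_subgroupD[OF N]
  obtain u v u' v' where uv: "w = (u, v)" "w' = (u', v')" by fastforce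
  have sq: "fst z \<in> points" "snd z \<in> points" using z by (auto simp: cell_def)
  have pos: "0 < fst z u" "0 < fst z u'" "0 < snd z v" "0 < snd z v'"
    using cell_pos[OF w(1) z(1)] cell_pos[OF w(2) z(2)] uv by auto
  have m: "valid e (u, v')" "z \<in> cell e (u, v')"
    using w z overlap_supports(7)[OF w z] by (auto simp: uv valid_def cell_def)
  have step_refl: "step w w = 0" for w :: "'v \<times> 'v" by (simp add: step_def)
  have 1: "step (u, v) (u, v') - (orient \<psi> v v' + c (u, v') - c (u, v)) \<in> N"
  proof (cases "v = v'")
    case False
    then show ?thesis using vertical points_edge(1)[OF sq(2) pos(3,4)] w m uv by blast
  qed (simp add: step_refl sub)
  have 2: "step (u, v') (u', v') - (orient \<phi> u u' + c (u', v') - c (u, v')) \<in> N"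
  proof (cases "u = u'")
    case False
    then show ?thesis using horizontal points_edge(1)[OF sq(1) pos(1,2)] w m uv by blast
  qed (simp add: step_refl sub)
  have 3: "step (u, v) (u, v') + step (u, v') (u', v') - step (u, v) (u', v') \<in> N"
    using step_cocycle[OF w(1) m(1) w(2) z(1) m(2) z(2)] BN uv by blast
  from sub(2)[OF sub(4)[OF 1 2] 3] show ?thesis
    by (simp add: uv algebra_simps)
qed

text \<open>
  The function \<open>spoke w z - height w z + c w\<close> changes only by elements of \<open>N\<close> when \<open>w\<close> is replaced by another
  cell that contains \<open>z\<close>, because spokes change by the step, heights by \<open>\<phi>\<close> and \<open>\<psi>\<close>, and the step is split
  accordingly.  It therefore serves as the global function \<open>G\<close> along which paths are coboundaries up
  to their change of height.
\<close>

lemma small_cycle_reduces: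
  assumes N: "additive_subgroup N" and BN: "boundaries e \<subseteq> N" and e: "e \<in> {0, 1}"
    and transition: "\<And>w w' z. valid e w \<Longrightarrow> valid e w' \<Longrightarrow> z \<in> cell e w \<Longrightarrow> z \<in> cell e w' \<Longrightarrow>
       step w w' - (orient \<phi> (fst w) (fst w') + orient \<psi> (snd w) (snd w') + c w' - c w) \<in> N"
    and cycle: "singular_relcycle 1 (pair_space e) {} b"
    and small: "\<And>f. f \<in> Poly_Mapping.keys b \<Longrightarrow> \<exists>w. valid e w \<and> f \<in> standard_simplex 1 \<rightarrow> cell e w"
  shows "b - frag_extend (height_change \<phi> \<psi>) b \<in> N"
proof -
  note sub = additive_subgroupD[OF N]
  let ?h = "height \<phi> \<psi>"
  define idx where "idx z = (SOME w. valid e w \<and> z \<in> cell e w)" for z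
  define G where "G z = spoke (idx z) z - ?h (idx z) z + c (idx z)" for z
  have G: "G z - (spoke w z - ?h w z + c w) \<in> N" if w: "valid e w" and z: "z \<in> cell e w" for w z
  proof -
    have idx: "valid e (idx z)" "z \<in> cell e (idx z)"
      unfolding idx_def using someI[of "\<lambda>w. valid e w \<and> z \<in> cell e w"] w z by blast+
    have 1: "spoke (idx z) z - spoke w z - step (idx z) w \<in> N"
      using spoke_difference idx w z BN by blast
    have 2: "step (idx z) w - (orient \<phi> (fst (idx z)) (fst w) + orient \<psi> (snd (idx z)) (snd w) + c w - c (idx z)) \<in> N"
      using transition idx w z by blast
    show ?thesis
      using sub(4)[OF 1 2] height_difference[OF idx(1) w idx(2) z, of \<phi> \<psi>, symmetric]
      by (simp add: G_def algebra_simps)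
  qed
  show ?thesis
  proof (rule cycle_reduces_to_transition_part[OF N])
    show "Poly_Mapping.keys b \<subseteq> {f. singular_simplex 1 (pair_space e) f \<and>
        (\<exists>w. valid e w \<and> f \<in> standard_simplex 1 \<rightarrow> cell e w)}"
      using cycle small by (auto simp: singular_cycle singular_chain_def simp del: One_nat_def)
    show "chain_boundary 1 b = 0" using cycle by (simp add: singular_cycle)
    fix f assume "f \<in> {f. singular_simplex 1 (pair_space e) f \<and>
        (\<exists>w. valid e w \<and> f \<in> standard_simplex 1 \<rightarrow> cell e w)}"
    then obtain w where f: "singular_simplex 1 (pair_space e) f" and w: "valid e w"
      and fw: "f \<in> standard_simplex 1 \<rightarrow> cell e w" by blast
    have ends: "f (corner 0) \<in> cell e w" "f (corner 1) \<in> cell e w" using fw by (auto simp: Pi_iff)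
    have "singular_simplex 1 (subtopology plane (cell e w)) f"
      using f fw by (auto simp: singular_simplex_subtopology simp del: One_nat_def)
    then have 1: "frag_of f - (spoke w (f (corner 1)) - spoke w (f (corner 0))) \<in> N"
      using path_in_cell[OF w] BN by blast
    have "f \<in> standard_simplex 1 \<rightarrow> cell 0 w" using fw cell_mono[OF w] by blast
    then have \<eta>: "height_change \<phi> \<psi> f = ?h w (f (corner 1)) - ?h w (f (corner 0))"
      using height_change_eq[OF valid_mono[OF w]] by blast
    show "frag_of f - (G (f (corner 1)) - G (f (corner 0))) - height_change \<phi> \<psi> f \<in> N"
      unfolding \<eta> using sub(2)[OF 1 sub(2)[OF G[OF w ends(2)] G[OF w ends(1)]]]
      by (simp add: algebra_simps)
  qed
qed

text \<open>
  Within one cell the height is a function, so its changes along the sides of a triangle cancel.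
\<close>

lemma height_change_of_boundary:
  assumes d: "\<And>f. f \<in> Poly_Mapping.keys d \<Longrightarrow> \<exists>w. valid 0 w \<and> f \<in> standard_simplex 2 \<rightarrow> cell 0 w"
  shows "frag_extend (height_change \<phi> \<psi>) (chain_boundary 2 d) = 0"
proof (rule transition_part_of_boundary)
  show "Poly_Mapping.keys d \<subseteq> {f. \<exists>w. valid 0 w \<and> f \<in> standard_simplex 2 \<rightarrow> cell 0 w}"
    using d by blast
  fix f assume "f \<in> {f. \<exists>w. valid 0 w \<and> f \<in> standard_simplex 2 \<rightarrow> cell 0 w}"
  then obtain w where w: "valid 0 w" and f: "f \<in> standard_simplex 2 \<rightarrow> cell 0 w" by blast
  have face: "singular_face 2 k f \<in> standard_simplex 1 \<rightarrow> cell 0 w" if "k \<le> 2" for k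
    using f simplical_face_in_standard_simplex[of 2 k] that
    by (auto simp: singular_face_def Pi_iff simp del: One_nat_def) 
  have \<eta>: "height_change \<phi> \<psi> (singular_face 2 k f) =
      height \<phi> \<psi> w (singular_face 2 k f (corner 1)) - height \<phi> \<psi> w (singular_face 2 k f (corner 0))" if "k \<le> 2" for k
    using height_change_eq[OF w face[OF that]] .
  show "height_change \<phi> \<psi> (singular_face 2 0 f) - height_change \<phi> \<psi> (singular_face 2 1 f)
      + height_change \<phi> \<psi> (singular_face 2 2 f) = 0"
    unfolding \<eta>[OF le0] \<eta>[OF one_le_numeral] \<eta>[OF order_refl] by (simp add: singular_face_corner)
qed

section \<open>The inclusion of the configuration space in first homology\<close>

lemma subdivide_into_cells:
  assumes e: "e \<in> {0, 1}" and c: "singular_chain p (pair_space e) c"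
  obtains n where "\<And>m f. n \<le> m \<Longrightarrow> f \<in> Poly_Mapping.keys ((singular_subdivision p ^^ m) c) \<Longrightarrow>
      \<exists>w. valid e w \<and> f \<in> standard_simplex p \<rightarrow> cell e w"
proof -
  have cover: "topspace (pair_space e) \<subseteq> \<Union> (cell e ` {w. valid e w})"
    using cells_cover[OF e] by auto
  have opn: "openin (pair_space e) U" if "U \<in> cell e ` {w. valid e w}" for U
    using that open_cell by blast
  show thesis
  proof (rule sufficient_iterated_singular_subdivision_exists[OF opn cover c])
    fix n assume n: "\<And>m f. n \<le> m \<Longrightarrow> f \<in> Poly_Mapping.keys ((singular_subdivision p ^^ m) c) \<Longrightarrow>
      \<exists>U \<in> cell e ` {w. valid e w}. f \<in> standard_simplex p \<rightarrow> U"
    show thesis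
    proof (rule that)
      fix m f assume "n \<le> m" "f \<in> Poly_Mapping.keys ((singular_subdivision p ^^ m) c)"
      from n[OF this] show "\<exists>w. valid e w \<and> f \<in> standard_simplex p \<rightarrow> cell e w" by blast
    qed
  qed
qed

text \<open>
  Both the cycle and the 2-chain that it bounds in the product are subdivided until they are small,
  the first with respect to the cells of the configuration space, the second with respect to the
  larger cells of the product.
\<close>

lemma inclusion_injective:
  assumes c: "singular_relcycle 1 (pair_space 1) {} c" and c0: "singular_relboundary 1 (pair_space 0) {} c"
  shows "singular_relboundary 1 (pair_space 1) {} c"
proof -
  show ?thesis
  proof (rule step_splits)
    fix \<phi> \<psi> k
    assume splits: "\<And>x y a. adjacent x y \<Longrightarrow> a \<in> V \<Longrightarrow> a \<noteq> x \<Longrightarrow> a \<noteq> y \<Longrightarrow>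
         step (x, a) (y, a) - (orient \<phi> x y + k (y, a) - k (x, a)) \<in> boundaries 1"
      "\<And>x y a. adjacent x y \<Longrightarrow> a \<in> V \<Longrightarrow> a \<noteq> x \<Longrightarrow> a \<noteq> y \<Longrightarrow>
         step (a, x) (a, y) - (orient \<psi> x y + k (a, y) - k (a, x)) \<in> boundaries 1"
      "\<And>x y. singular_relcycle 1 (pair_space 1) {} (orient \<phi> x y)"
      "\<And>x y. singular_relcycle 1 (pair_space 1) {} (orient \<psi> x y)"
    obtain d where d: "singular_chain 2 (pair_space 0) d" "chain_boundary 2 d = c"
      using c0 by (auto simp: singular_boundary numeral_2_eq_2)
    have chain: "singular_chain 1 (pair_space 1) c" using c by (simp add: singular_cycle)
    obtain n1 where n1: "\<And>m f. n1 \<le> m \<Longrightarrow> f \<in> Poly_Mapping.keys ((singular_subdivision 1 ^^ m) c) \<Longrightarrow>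
        \<exists>w. valid 1 w \<and> f \<in> standard_simplex 1 \<rightarrow> cell 1 w"
      by (rule subdivide_into_cells[OF _ chain]) auto
    obtain n2 where n2: "\<And>m f. n2 \<le> m \<Longrightarrow> f \<in> Poly_Mapping.keys ((singular_subdivision 2 ^^ m) d) \<Longrightarrow>
        \<exists>w. valid 0 w \<and> f \<in> standard_simplex 2 \<rightarrow> cell 0 w"
      by (rule subdivide_into_cells[OF _ d(1)]) auto
    define n where "n = max n1 n2"
    let ?c = "(singular_subdivision 1 ^^ n) c" and ?d = "(singular_subdivision 2 ^^ n) d"
    have hom: "homologous_rel 1 (pair_space 1) {} ?c c"
      by (rule iterated_subdivision_homologous[OF c])
    have bd: "chain_boundary 2 ?d = ?c"
      using chain_boundary_iterated_subdivision[OF d(1), of n] d(2) by simp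
    have "?c - frag_extend (height_change \<phi> \<psi>) ?c \<in> boundaries 1"
    proof (rule small_cycle_reduces[OF additive_subgroup_boundaries_pairs order_refl])
      show "singular_relcycle 1 (pair_space 1) {} ?c"
        using homologous_rel_singular_relcycle[OF hom] c by simp
      show "step w w' - (orient \<phi> (fst w) (fst w') + orient \<psi> (snd w) (snd w') + k w' - k w) \<in> boundaries 1"
        if "valid 1 w" "valid 1 w'" "z \<in> cell 1 w" "z \<in> cell 1 w'" for w w' z
        using that by (intro step_transition[OF additive_subgroup_boundaries_pairs order_refl] splits)
          (auto simp: valid_def)
      show "\<exists>w. valid 1 w \<and> f \<in> standard_simplex 1 \<rightarrow> cell 1 w" if "f \<in> Poly_Mapping.keys ?c" for f
        using n1[of n f] that by (simp add: n_def)
    qed simp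
    moreover have "frag_extend (height_change \<phi> \<psi>) ?c = 0"
      unfolding bd[symmetric] by (rule height_change_of_boundary, rule n2) (auto simp: n_def)
    ultimately have "singular_relboundary 1 (pair_space 1) {} ?c"
      by (simp add: boundaries_def)
    moreover have "singular_relboundary 1 (pair_space 1) {} (?c - c)"
      using hom by (simp add: homologous_rel_def)
    ultimately show ?thesis
      using singular_relboundary_diff by fastforce
  qed
qed

text \<open>
  For neighbours \<open>y \<noteq> z\<close> of \<open>x\<close>, the square spanned by the edges \<open>xy\<close> and \<open>xz\<close> has one corner on the
  diagonal, and the other two sides are known.  It shows that the value at \<open>(x, x)\<close> required by the
  move of the first point to \<open>y\<close> equals the one required by the move of the second point to \<open>z\<close>.  With
  three neighbours all required values coincide.
\<close>

lemma steps_extend_over_diagonal: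
  assumes N: "additive_subgroup N" and BN: "boundaries 0 \<subseteq> N"
    and horizontal: "\<And>x y a. adjacent x y \<Longrightarrow> a \<in> V \<Longrightarrow> a \<noteq> x \<Longrightarrow> a \<noteq> y \<Longrightarrow>
       step (x, a) (y, a) - (k (y, a) - k (x, a)) \<in> N"
    and vertical: "\<And>x y a. adjacent x y \<Longrightarrow> a \<in> V \<Longrightarrow> a \<noteq> x \<Longrightarrow> a \<noteq> y \<Longrightarrow>
       step (a, x) (a, y) - (k (a, y) - k (a, x)) \<in> N"
  obtains k' where
    "\<And>x y a. adjacent x y \<Longrightarrow> a \<in> V \<Longrightarrow> step (x, a) (y, a) - (k' (y, a) - k' (x, a)) \<in> N"
    "\<And>x y a. adjacent x y \<Longrightarrow> a \<in> V \<Longrightarrow> step (a, x) (a, y) - (k' (a, y) - k' (a, x)) \<in> N"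
proof -
  note sub = additive_subgroupD[OF N]
  have third: "\<exists>z. adjacent x z \<and> z \<noteq> y \<and> z \<noteq> y'" if x: "x \<in> V" for x y y'
  proof (cases "x \<in> P")
    case True
    then show ?thesis using Q3[of y y'] by (auto simp: adjacent_def)
  next
    case False
    then show ?thesis using P3[of y y'] x by (auto simp: adjacent_def)
  qed
  have adj_sym: "adjacent y x" if "adjacent x y" for x y using that by (auto simp: adjacent_def)
  define g where "g x y = step (x, x) (y, x) - k (y, x)" for x y
  define h where "h x y = step (x, x) (x, y) - k (x, y)" for x y
  have gh: "g x y - h x z \<in> N" if xy: "adjacent x y" and xz: "adjacent x z" and yz: "y \<noteq> z" for x y z
  proof -
    note ne = adjacentD[OF xy] adjacentD[OF xz]
    have 1: "step (x, x) (y, x) + step (y, x) (y, z) - step (x, x) (x, z) - step (x, z) (y, z) \<in> N"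
      using step_square[OF xy xz, of 0] BN by auto
    have 2: "step (y, x) (y, z) - (k (y, z) - k (y, x)) \<in> N"
      using ne yz by (intro vertical xz) auto
    have 3: "step (x, z) (y, z) - (k (y, z) - k (x, z)) \<in> N"
      using ne yz by (intro horizontal xy) auto
    from sub(4)[OF sub(2)[OF 1 2] 3] show ?thesis by (simp add: g_def h_def algebra_simps)
  qed
  have "\<forall>x\<in>V. \<exists>z. adjacent x z" using third by blast
  then obtain nb where nb: "\<And>x. x \<in> V \<Longrightarrow> adjacent x (nb x)" by metis
  have h_const: "h x z - g x (nb x) \<in> N" if xz: "adjacent x z" for x z
  proof -
    have x: "x \<in> V" using adjacentD[OF xz] by blast
    obtain z' where z': "adjacent x z'" "z' \<noteq> nb x" "z' \<noteq> z" using third[OF x] by blast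
    obtain y where y: "adjacent x y" "y \<noteq> z" "y \<noteq> z'" using third[OF x] by blast
    have eq: "h x z - g x (nb x) = (g x y - h x z') - (g x (nb x) - h x z') - (g x y - h x z)"
      by simp
    show ?thesis unfolding eq by (intro sub(2) gh) (use xz z' y nb[OF x] in auto)
  qed
  have g_const: "g x y - g x (nb x) \<in> N" if xy: "adjacent x y" for x y
  proof -
    have x: "x \<in> V" using adjacentD[OF xy] by blast
    obtain z where z: "adjacent x z" "z \<noteq> y" using third[OF x] by blast
    have eq: "g x y - g x (nb x) = (g x y - h x z) + (h x z - g x (nb x))" by simp
    show ?thesis unfolding eq by (intro sub(4) gh h_const) (use xy z in auto)
  qed
  define k' where "k' = (\<lambda>(x, y). if x = y then - g x (nb x) else k (x, y))"
  show thesis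
  proof (rule that)
    fix x y a assume xy: "adjacent x y" and a: "a \<in> V"
    have ne: "x \<noteq> y" "y \<noteq> x" using adjacentD[OF xy] by auto
    consider "a = x" | "a = y" | "a \<noteq> x" "a \<noteq> y" by blast
    then show "step (x, a) (y, a) - (k' (y, a) - k' (x, a)) \<in> N"
    proof cases
      case 1
      then show ?thesis using g_const[OF xy] ne by (simp add: k'_def g_def algebra_simps)
    next
      case 2
      then show ?thesis
        using sub(3)[OF g_const[OF adj_sym[OF xy]]] ne
        by (simp add: k'_def g_def step_reverse[of "(x, y)" "(y, y)"] algebra_simps)
    next
      case 3
      then show ?thesis using horizontal[OF xy a] by (simp add: k'_def)
    qed
    consider "a = x" | "a = y" | "a \<noteq> x" "a \<noteq> y" by blast
    then show "step (a, x) (a, y) - (k' (a, y) - k' (a, x)) \<in> N"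
    proof cases
      case 1
      then show ?thesis using h_const[OF xy] ne by (simp add: k'_def h_def algebra_simps)
    next
      case 2
      then show ?thesis
        using sub(3)[OF h_const[OF adj_sym[OF xy]]] ne
        by (simp add: k'_def h_def step_reverse[of "(y, x)" "(y, y)"] algebra_simps)
    next
      case 3
      then show ?thesis using vertical[OF xy a] by (simp add: k'_def)
    qed
  qed
qed

text \<open>
  The cycle is reduced modulo the subgroup generated by the boundaries of the product and the cycles
  of the configuration space; there the splitting has \<open>\<phi> = \<psi> = 0\<close>, so there is no height to change.
\<close>

lemma inclusion_surjective:
  assumes c: "singular_relcycle 1 (pair_space 0) {} c"
  shows "\<exists>d. singular_relcycle 1 (pair_space 1) {} d \<and> homologous_rel 1 (pair_space 0) {} c d"
proof -
  define N where "N = {b + z | b z. singular_relboundary 1 (pair_space 0) {} b \<and>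
      singular_relcycle 1 (pair_space 1) {} z}"
  have N: "additive_subgroup N" unfolding N_def by (rule additive_subgroup_boundaries_plus_cycles)
  note sub = additive_subgroupD[OF N]
  have B0: "boundaries 0 \<subseteq> N"
    using singular_relcycle_0 by (force simp: N_def boundaries_def simp del: One_nat_def)
  have Z1: "z \<in> N" if "singular_relcycle 1 (pair_space 1) {} z" for z
    using that singular_relboundary_0 by (force simp: N_def simp del: One_nat_def)
  have B1: "boundaries 1 \<subseteq> N"
  proof
    fix z assume "z \<in> boundaries 1"
    then have "singular_relboundary 1 (pair_space 1) {} z" by (simp add: boundaries_def)
    then show "z \<in> N" by (intro Z1 singular_relboundary_imp_relcycle)
  qed
  show ?thesis
  proof (rule step_splits)
    fix \<phi> \<psi> k
    assume splits: "\<And>x y a. adjacent x y \<Longrightarrow> a \<in> V \<Longrightarrow> a \<noteq> x \<Longrightarrow> a \<noteq> y \<Longrightarrow>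
         step (x, a) (y, a) - (orient \<phi> x y + k (y, a) - k (x, a)) \<in> boundaries 1"
      "\<And>x y a. adjacent x y \<Longrightarrow> a \<in> V \<Longrightarrow> a \<noteq> x \<Longrightarrow> a \<noteq> y \<Longrightarrow>
         step (a, x) (a, y) - (orient \<psi> x y + k (a, y) - k (a, x)) \<in> boundaries 1"
      and cycles: "\<And>x y. singular_relcycle 1 (pair_space 1) {} (orient \<phi> x y)"
      "\<And>x y. singular_relcycle 1 (pair_space 1) {} (orient \<psi> x y)"
    have off_diagonal: "step (x, a) (y, a) - (k (y, a) - k (x, a)) \<in> N" "step (a, x) (a, y) - (k (a, y) - k (a, x)) \<in> N"
      if "adjacent x y" "a \<in> V" "a \<noteq> x" "a \<noteq> y" for x y a
    proof -
      have "step (x, a) (y, a) - (orient \<phi> x y + k (y, a) - k (x, a)) \<in> N"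
        "step (a, x) (a, y) - (orient \<psi> x y + k (a, y) - k (a, x)) \<in> N"
        using splits that B1 by blast+
      from sub(4)[OF this(1) Z1[OF cycles(1)[of x y]]] sub(4)[OF this(2) Z1[OF cycles(2)[of x y]]]
      show "step (x, a) (y, a) - (k (y, a) - k (x, a)) \<in> N" "step (a, x) (a, y) - (k (a, y) - k (a, x)) \<in> N"
        by (simp_all add: algebra_simps)
    qed
    show ?thesis
    proof (rule steps_extend_over_diagonal[OF N B0 off_diagonal])
      fix k'
      assume k': "\<And>x y a. adjacent x y \<Longrightarrow> a \<in> V \<Longrightarrow> step (x, a) (y, a) - (k' (y, a) - k' (x, a)) \<in> N"
        "\<And>x y a. adjacent x y \<Longrightarrow> a \<in> V \<Longrightarrow> step (a, x) (a, y) - (k' (a, y) - k' (a, x)) \<in> N"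
      have orient_0: "orient (\<lambda>_ _. 0) x y = 0" for x y by (simp add: orient_def)
      have chain: "singular_chain 1 (pair_space 0) c" using c by (simp add: singular_cycle)
      obtain n where n: "\<And>m f. n \<le> m \<Longrightarrow> f \<in> Poly_Mapping.keys ((singular_subdivision 1 ^^ m) c) \<Longrightarrow>
          \<exists>w. valid 0 w \<and> f \<in> standard_simplex 1 \<rightarrow> cell 0 w"
        by (rule subdivide_into_cells[OF _ chain]) auto
      let ?c = "(singular_subdivision 1 ^^ n) c"
      let ?o = "\<lambda>(_::'v) (_::'v). 0 :: (('v \<Rightarrow> real) \<times> ('v \<Rightarrow> real)) chain"
      have hom: "homologous_rel 1 (pair_space 0) {} ?c c"
        by (rule iterated_subdivision_homologous[OF c])
      have "?c - frag_extend (height_change ?o ?o) ?c \<in> N"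
      proof (rule small_cycle_reduces[OF N B0])
        show "singular_relcycle 1 (pair_space 0) {} ?c"
          using homologous_rel_singular_relcycle[OF hom] c by simp
        show "step w w' - (orient ?o (fst w) (fst w') + orient ?o (snd w) (snd w') + k' w' - k' w) \<in> N"
          if "valid 0 w" "valid 0 w'" "z \<in> cell 0 w" "z \<in> cell 0 w'" for w w' z
          using that by (intro step_transition[OF N B0]) (auto simp: valid_def orient_0 k')
        show "\<exists>w. valid 0 w \<and> f \<in> standard_simplex 1 \<rightarrow> cell 0 w" if "f \<in> Poly_Mapping.keys ?c" for f
          using n[of n f] that by simp
      qed simp
      moreover have "frag_extend (height_change ?o ?o) ?c = 0"
        by (rule frag_extend_eq_0) (simp add: height_change_def height_def orient_0)
      ultimately have "?c \<in> N" by simp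
      then obtain b z where bz: "?c = b + z" "singular_relboundary 1 (pair_space 0) {} b"
        "singular_relcycle 1 (pair_space 1) {} z" by (auto simp: N_def)
      have "homologous_rel 1 (pair_space 0) {} ?c z"
        using bz by (simp add: homologous_rel_def)
      then have "homologous_rel 1 (pair_space 0) {} c z"
        using hom homologous_rel_sym homologous_rel_trans by blast
      then show ?thesis using bz(3) by blast
    qed
  qed
qed

section \<open>Connectedness, and comparison with the interval\<close>

lemma geometric_realization_K: "geometric_realization K = subtopology (powertop_real UNIV) points"
  by (simp add: geometric_realization_def points_def)

lemma segment_connects:
  fixes x y :: "'v \<Rightarrow> real"
  assumes "\<And>t. 0 \<le> t \<Longrightarrow> t \<le> 1 \<Longrightarrow> (\<lambda>v. (1 - t) * x v + t * y v) \<in> A"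
  shows "connected_component_of (subtopology (powertop_real UNIV) A) x y"
proof -
  let ?g = "\<lambda>t v. (1 - t) * x v + t * y v"
  have "continuous_map (top_of_set {0..1::real}) (subtopology (powertop_real UNIV) A) ?g"
    using assms
    by (auto simp: continuous_map_in_subtopology continuous_map_componentwise_UNIV
        intro!: continuous_intros)
  then have "connectedin (subtopology (powertop_real UNIV) A) (?g ` {0..1})"
    by (rule connectedin_continuous_map_image) (simp add: connectedin_subtopology)
  moreover have "x \<in> ?g ` {0..1}" "y \<in> ?g ` {0..1}"
    by (auto intro: image_eqI[of _ _ 0] image_eqI[of _ _ 1])
  ultimately show ?thesis unfolding connected_component_of_def by blast
qed

text \<open>
  Every point can be moved to a vertex other than \<open>a\<close> without meeting \<open>a\<close>, and such vertices are joined by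
  edge paths of length at most two.  The set \<open>D\<close> is empty or the vertex \<open>a\<close>, so that the whole polyhedron
  is covered too.
\<close>

lemma connected_punctured:
  assumes D: "D \<subseteq> {vertex a}"
  shows "connected_space (subtopology (powertop_real UNIV) (points - D))"
proof -
  let ?X = "subtopology (powertop_real UNIV) (points - D)"
  let ?c = "connected_component_of ?X"
  have not_a: "x \<notin> D" if "x v \<noteq> vertex a v" for x v using D that by auto
  have sym: "?c y x" if "?c x y" for x y using that connected_component_of_sym by metis
  have trans: "?c x z" if "?c x y" "?c y z" for x y z
    using that connected_component_of_trans by metis
  have to_vertex: "?c x (vertex v)" if x: "x \<in> points" "0 < x v" and v: "v \<noteq> a" for x v
  proof (rule segment_connects)
    fix t :: real assume t: "0 \<le> t" "t \<le> 1"
    let ?z = "\<lambda>w. (1 - t) * x w + t * vertex v w"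
    have "{w. 0 < x w} \<union> {w. 0 < vertex v w} = {w. 0 < x w}"
      using x by (auto simp: vertex_support)
    then have "?z \<in> points"
      using x points_vertex[OF x] vertex_in_points points_support t
      by (intro segment_in_points) auto
    moreover have "0 < ?z v"
      using convex_pos[OF t x(2), of 1] by (simp add: vertex_def)
    then have "?z \<notin> D"
      using v by (intro not_a[of _ v]) (simp add: vertex_def)
    ultimately show "?z \<in> points - D" by blast
  qed
  have edge: "?c (vertex u) (vertex v)" if uv: "adjacent u v" and ne: "u \<noteq> a" "v \<noteq> a" for u v
  proof (rule segment_connects)
    fix t :: real assume t: "0 \<le> t" "t \<le> 1"
    let ?z = "\<lambda>w. (1 - t) * vertex u w + t * vertex v w"
    have "?z \<in> points"
      using adjacentD[OF uv] adjacent_in_K[OF uv] t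
      by (intro segment_in_points vertex_in_points) (auto simp: vertex_support insert_commute)
    moreover have "?z \<notin> D"
      using ne by (intro not_a[of _ a]) (simp add: vertex_def)
    ultimately show "?z \<in> points - D" by blast
  qed
  obtain p where p: "p \<in> P" "p \<noteq> a" using P3 by blast
  obtain q where q: "q \<in> Q" "q \<noteq> a" using Q3 by blast
  have hub: "?c (vertex v) (vertex p)" if v: "v \<in> V" "v \<noteq> a" for v
  proof (cases "v \<in> P")
    case True
    then have "?c (vertex v) (vertex q)" "?c (vertex q) (vertex p)"
      using v p q by (auto intro!: edge simp: adjacent_def)
    then show ?thesis by (rule trans)
  next
    case False
    then show ?thesis using v p by (auto intro!: edge simp: adjacent_def)
  qed
  have "?c x (vertex p)" if x: "x \<in> points - D" for x
  proof (cases "\<exists>v. v \<noteq> a \<and> 0 < x v")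
    case True
    then obtain v where v: "v \<noteq> a" "0 < x v" by blast
    then show ?thesis
      using trans[OF to_vertex hub] x points_vertex[of x v] by blast
  next
    case False
    then have supp: "{w. 0 < x w} = {a}" "a \<in> V"
      using points_exists_pos[of x] x by auto
    have zero: "x w = 0" if "w \<noteq> a" for w
      using False that points_nonneg[of x w] x by force
    have "x a = sum x V"
      using supp(2) finite_PQ zero by (subst sum.remove[of _ a]) auto
    then have "x = vertex a"
      using x sum_points zero by (auto simp: vertex_def fun_eq_iff)
    then have "D = {}" using x D by auto
    have "?c (vertex a) (vertex v)" if av: "adjacent a v" for v
    proof (rule segment_connects)
      fix t :: real assume "0 \<le> t" "t \<le> 1"
      then show "(\<lambda>w. (1 - t) * vertex a w + t * vertex v w) \<in> points - D"
        unfolding \<open>D = {}\<close> Diff_empty using adjacentD[OF av] adjacent_in_K[OF av]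
        by (intro segment_in_points vertex_in_points) (auto simp: vertex_support insert_commute)
    qed
    moreover have "adjacent a p \<or> adjacent a q" using supp(2) p q by (auto simp: adjacent_def)
    ultimately show ?thesis
      using trans hub p q \<open>x = vertex a\<close> by blast
  qed
  then show ?thesis
    unfolding connected_space_iff_connected_component by (auto intro: trans sym)
qed

text \<open>
  Removing an inner point disconnects the interval, so a homeomorphism would send all vertices to
  the two end points.
\<close>

lemma not_homeomorphic_interval:
  "\<not> geometric_realization K homeomorphic_space top_of_set {0..1::real}"
proof
  assume "geometric_realization K homeomorphic_space top_of_set {0..1::real}"
  then obtain f where f: "homeomorphic_map (geometric_realization K) (top_of_set {0..1::real}) f"
    using homeomorphic_space by blast
  have top: "topspace (geometric_realization K) = points"
    by (simp add: geometric_realization_K)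
  have image: "f ` points = {0..1}" and inj: "inj_on f points"
    using f homeomorphic_imp_surjective_map[OF f] homeomorphic_imp_injective_map[OF f] top by auto
  have ends: "f (vertex a) \<in> {0, 1}" if a: "a \<in> V" for a
  proof (rule ccontr)
    assume inner: "f (vertex a) \<notin> {0, 1}"
    have fa: "f (vertex a) \<in> {0..1}" using vertex_in_points[OF a] image by blast
    have "connectedin (geometric_realization K) (points - {vertex a})"
      using connected_punctured[of "{vertex a}" a]
      by (simp add: connectedin_def geometric_realization_K subtopology_subtopology Int_absorb1)
    then have "connectedin (top_of_set {0..1}) (f ` (points - {vertex a}))"
      using homeomorphic_map_connectedness[OF f] top by blast
    moreover have "f ` (points - {vertex a}) = {0..1} - {f (vertex a)}"
      using image inj vertex_in_points[OF a] by (auto simp: inj_on_def)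
    ultimately have "connected ({0..1} - {f (vertex a)})"
      by (simp add: connectedin_subtopology)
    moreover have "0 \<in> {0..1} - {f (vertex a)}" "1 \<in> {0..1} - {f (vertex a)}" using inner by auto
    ultimately have "{0..1} \<subseteq> {0..1} - {f (vertex a)}"
      using connected_contains_Icc by blast
    then show False using fa by blast
  qed
  obtain a where a: "a \<in> P" using P3 by blast
  obtain b where b: "b \<in> P" "b \<noteq> a" using P3 by blast
  obtain c where c: "c \<in> P" "c \<noteq> a" "c \<noteq> b" using P3 by blast
  have inj_vertex: "u = v" if "vertex u = vertex v" for u v :: 'v
    using fun_cong[OF that, of u] by (simp add: vertex_def split: if_splits)
  have "f (vertex u) \<noteq> f (vertex v)" if "u \<in> P" "v \<in> P" "u \<noteq> v" for u v
    using inj_onD[OF inj, of "vertex u" "vertex v"] that vertex_in_points inj_vertex by blast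
  then have "f (vertex a) \<noteq> f (vertex b)" "f (vertex a) \<noteq> f (vertex c)" "f (vertex b) \<noteq> f (vertex c)"
    using a b c by metis+
  moreover have "f (vertex a) \<in> {0, 1}" "f (vertex b) \<in> {0, 1}" "f (vertex c) \<in> {0, 1}"
    using ends a b c by blast+
  ultimately show False by auto
qed

lemma mature_K: "mature K"
proof -
  let ?X = "geometric_realization K"
  have sq: "prod_topology ?X ?X = pair_space 0"
    by (simp add: geometric_realization_K pairs_def flip: subtopology_Times)
  have conf: "config_space2 ?X = pair_space 1"
    unfolding config_space2_def sq
    by (auto simp: subtopology_subtopology pairs_def intro!: arg_cong[where f = "subtopology plane"])
  have "hom_induced 1 (pair_space 1) {} (pair_space 0) {} id
      \<in> iso (homology_group 1 (pair_space 1)) (homology_group 1 (pair_space 0))"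
    using inclusion_iso_homology[OF pairs_mono, of 1 plane 1] inclusion_injective inclusion_surjective
    by simp
  moreover have "connected_space ?X"
    using connected_punctured[of "{}"] by (simp add: geometric_realization_K)
  ultimately show ?thesis
    unfolding mature_def Let_def sq conf using graph_complex_K not_homeomorphic_interval by blast
qed

end

theorem proposition22:
  fixes P Q :: "'v set" and p q :: nat
  assumes "finite P" and "finite Q" and "P \<inter> Q = {}"
    and "card P = p" and "card Q = q"
    and "p \<ge> 3" and "q \<ge> 3"
  shows "mature (complete_bipartite P Q)"
proof -
  have third: "\<exists>z\<in>S. z \<noteq> x \<and> z \<noteq> y" if "finite S" "card S \<ge> 3" for S :: "'v set" and x y
  proof -
    have "card {x, y} \<le> 2" by (simp add: card_insert_if)
    then have "\<not> S \<subseteq> {x, y}" using that card_mono[of "{x, y}" S] by force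
    then show ?thesis by blast
  qed
  interpret bipartite P Q
    using assms third by unfold_locales auto
  show ?thesis by (rule mature_K)
qed

end
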